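(* Let $\mathcal J$ be a positive geometric chain of ideals in $\Phi^+$ of length $m$, let $R=R_{\mathcal J}$ be the corresponding bounded dominant region of $\mathcal A^m_\Phi$, and let $w_R\in W_a$ be the unique element with $r(w_R,\alpha)=r_\alpha(\mathcal J)$ for all $\alpha\in\Phi^+$. For each $1\le r\le m$ the following three sets coincide: (i) the set of roots $\alpha\in\Phi^+$ that are indecomposable of rank $r$ with respect to $\mathcal J$; (ii) the set of $\alpha\in\Phi^+$ such that $H_{\alpha,r}$ is a wall of $R$ which does not separate $R$ from $A_\circ$; (iii) the set of $\alpha\in\Phi^+$ such that $H_{\alpha,r}$ is a wall of $w_RA_\circ$ which does not separate $w_RA_\circ$ from $A_\circ$.
   Context: $\Phi$ irreducible crystallographic of rank $\ell$ in Euclidean $V$, positive system $\Phi^+$, simple roots $\Pi=\{\sigma_i\}$, highest root $\tilde\alpha$; $H_{\alpha,k}=\{x:(\alpha,x)=k\}$; $\mathcal A^m_\Phi$ consists of $H_{\alpha,k}$, $\alpha\in\Phi$, $0\le k\le m$. $W_a$ is generated by reflections in all $H_{\alpha,k}$, $k\in\mathbb Z$; $A_\circ=\{x:(\sigma_i,x)>0,(\tilde\alpha,x)<1\}$; $r(w,\alpha)$ is the integer $r$ with $r-1<(\alpha,x)<r$ on $wA_\circ$. A wall of a region or alcove is a hyperplane supporting a facet of its closure; "does not separate" means both sets lie in the same open half-space. Positive geometric chain of ideals of length $m$: ideals (down-sets of the root poset) $\emptyset=\mathcal J_0\subseteq\cdots\subseteq\mathcal J_m$ with $(\mathcal J_i+\mathcal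 J_j)\cap\Phi^+\subseteq\mathcal J_{i+j}$ for $i+j\le m$, $(\mathcal I_i+\mathcal I_j)\cap\Phi^+\subseteq\mathcal I_{i+j}$ for all $i,j$ ($\mathcal I_i=\Phi^+\setminus\mathcal J_i$ for $i\le m$, $=\mathcal I_m$ for $i>m$), $\Pi\subseteq\mathcal J_m$. $R_{\mathcal J}=\{x: (\alpha,x)>r \text{ for }\alpha\in\mathcal I_r,\ 0<(\alpha,x)<r\text{ for }\alpha\in\mathcal J_r,\ 0\le r\le m\}$. $r_\alpha(\mathcal J)=\min\{r_1+\cdots+r_k:\alpha=\alpha_1+\cdots+\alpha_k,\alpha_i\in\mathcal J_{r_i}\}$. $\alpha\in\Phi^+$ is indecomposable of rank $r$ ($1\le r\le m$) w.r.t. $\mathcal J$ if $\alpha\in\mathcal J_r$, $r_\alpha(\mathcal J)=r$, $\alpha$ is not $\beta+\gamma$ with $\beta\in\mathcal J_i,\gamma\in\mathcal J_j$, $i,j\ge1$, $i+j=r$, and whenever $\beta\in\Phi^+$ with $r_{\alpha+\beta}(\mathcal J)=t\le m$ we have $\beta\in\mathcal J_{t-r}$. *)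

theory Defs
  imports "HOL-Analysis.Analysis"
begin

definition refl_aff :: "'a::euclidean_space \<Rightarrow> real \<Rightarrow> 'a \<Rightarrow> 'a" where
  "refl_aff \<alpha> k x = x - ((2 * (\<alpha> \<bullet> x - k)) / (\<alpha> \<bullet> \<alpha>)) *\<^sub>R \<alpha>"

definition hyp :: "'a::euclidean_space \<Rightarrow> real \<Rightarrow> 'a set" where
  "hyp \<alpha> k = {x. \<alpha> \<bullet> x = k}"

definition root_system :: "'a::euclidean_space set \<Rightarrow> bool" where
  "root_system \<Phi> \<longleftrightarrow> finite \<Phi> \<and> 0 \<notin> \<Phi> \<and> span \<Phi> = UNIV
     \<and> (\<forall>\<alpha>\<in>\<Phi>. \<forall>c::real. c *\<^sub>R \<alpha> \<in> \<Phi> \<longrightarrow> c = 1 \<or> c = -1)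
     \<and> (\<forall>\<alpha>\<in>\<Phi>. \<forall>\<beta>\<in>\<Phi>. refl_aff \<alpha> 0 \<beta> \<in> \<Phi>)
     \<and> (\<forall>\<alpha>\<in>\<Phi>. \<forall>\<beta>\<in>\<Phi>. 2 * (\<alpha> \<bullet> \<beta>) / (\<alpha> \<bullet> \<alpha>) \<in> \<int>)"

definition irreducible_rs :: "'a::euclidean_space set \<Rightarrow> bool" where
  "irreducible_rs \<Phi> \<longleftrightarrow> \<not> (\<exists>A B. A \<noteq> {} \<and> B \<noteq> {} \<and> A \<union> B = \<Phi> \<and> A \<inter> B = {}
       \<and> (\<forall>\<alpha>\<in>A. \<forall>\<beta>\<in>B. \<alpha> \<bullet> \<beta> = 0))"

definition nonneg_comb :: "'a::euclidean_space set \<Rightarrow> 'a \<Rightarrow> bool" where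
  "nonneg_comb \<Delta> v \<longleftrightarrow> (\<exists>c::'a \<Rightarrow> real. (\<forall>\<sigma>\<in>\<Delta>. c \<sigma> \<ge> 0) \<and> v = (\<Sum>\<sigma>\<in>\<Delta>. c \<sigma> *\<^sub>R \<sigma>))"

definition simple_system :: "'a::euclidean_space set \<Rightarrow> 'a set \<Rightarrow> bool" where
  "simple_system \<Phi> \<Delta> \<longleftrightarrow> \<Delta> \<subseteq> \<Phi> \<and> independent \<Delta>
     \<and> (\<forall>\<alpha>\<in>\<Phi>. nonneg_comb \<Delta> \<alpha> \<or> nonneg_comb \<Delta> (- \<alpha>))"

definition pos_roots :: "'a::euclidean_space set \<Rightarrow> 'a set \<Rightarrow> 'a set" where
  "pos_roots \<Phi> \<Delta> = {\<alpha>\<in>\<Phi>. nonneg_comb \<Delta> \<alpha>}"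

definition root_le :: "'a::euclidean_space set \<Rightarrow> 'a \<Rightarrow> 'a \<Rightarrow> bool" where
  "root_le \<Delta> \<beta> \<alpha> \<longleftrightarrow> nonneg_comb \<Delta> (\<alpha> - \<beta>)"

definition highest_root :: "'a::euclidean_space set \<Rightarrow> 'a set \<Rightarrow> 'a \<Rightarrow> bool" where
  "highest_root \<Phi> \<Delta> \<theta> \<longleftrightarrow> \<theta> \<in> pos_roots \<Phi> \<Delta> \<and> (\<forall>\<beta>\<in>pos_roots \<Phi> \<Delta>. root_le \<Delta> \<beta> \<theta>)"

inductive_set affine_weyl :: "'a::euclidean_space set \<Rightarrow> ('a \<Rightarrow> 'a) set" for \<Phi> where
  aw_id: "id \<in> affine_weyl \<Phi>"
| aw_refl: "\<alpha> \<in> \<Phi> \<Longrightarrow> w \<in> affine_weyl \<Phi> \<Longrightarrow> refl_aff \<alpha> (of_int k) \<circ> w \<in> affine_weyl \<Phi>"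

definition fund_alcove :: "'a::euclidean_space set \<Rightarrow> 'a \<Rightarrow> 'a set" where
  "fund_alcove \<Delta> \<theta> = {x. (\<forall>\<sigma>\<in>\<Delta>. \<sigma> \<bullet> x > 0) \<and> \<theta> \<bullet> x < 1}"

definition r_w :: "'a::euclidean_space set \<Rightarrow> 'a \<Rightarrow> ('a \<Rightarrow> 'a) \<Rightarrow> 'a \<Rightarrow> int" where
  "r_w \<Delta> \<theta> w \<alpha> = (THE r::int. \<forall>x\<in>w ` fund_alcove \<Delta> \<theta>. of_int r - 1 < \<alpha> \<bullet> x \<and> \<alpha> \<bullet> x < of_int r)"

definition is_wall :: "'a::euclidean_space \<Rightarrow> real \<Rightarrow> 'a set \<Rightarrow> bool" where
  "is_wall \<alpha> k S \<longleftrightarrow> \<alpha> \<noteq> 0 \<and> (\<exists>F. F facet_of closure S \<and> F \<subseteq> hyp \<alpha> k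
     \<and> ((\<forall>x\<in>closure S. \<alpha> \<bullet> x \<le> k) \<or> (\<forall>x\<in>closure S. \<alpha> \<bullet> x \<ge> k)))"

definition not_separates :: "'a::euclidean_space \<Rightarrow> real \<Rightarrow> 'a set \<Rightarrow> 'a set \<Rightarrow> bool" where
  "not_separates \<alpha> k S T \<longleftrightarrow>
     ((\<forall>x\<in>S. \<alpha> \<bullet> x < k) \<and> (\<forall>x\<in>T. \<alpha> \<bullet> x < k)) \<or>
     ((\<forall>x\<in>S. \<alpha> \<bullet> x > k) \<and> (\<forall>x\<in>T. \<alpha> \<bullet> x > k))"

definition root_ideal :: "'a::euclidean_space set \<Rightarrow> 'a set \<Rightarrow> 'a set \<Rightarrow> bool" where
  "root_ideal \<Phi> \<Delta> S \<longleftrightarrow> S \<subseteq> pos_roots \<Phi> \<Delta> \<and>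
     (\<forall>\<beta>\<in>S. \<forall>\<gamma>\<in>pos_roots \<Phi> \<Delta>. root_le \<Delta> \<gamma> \<beta> \<longrightarrow> \<gamma> \<in> S)"

definition setsum :: "'a::euclidean_space set \<Rightarrow> 'a set \<Rightarrow> 'a set" where
  "setsum A B = {\<beta> + \<gamma> | \<beta> \<gamma>. \<beta> \<in> A \<and> \<gamma> \<in> B}"

definition co_chain :: "'a::euclidean_space set \<Rightarrow> 'a set \<Rightarrow> (nat \<Rightarrow> 'a set) \<Rightarrow> nat \<Rightarrow> nat \<Rightarrow> 'a set" where
  "co_chain \<Phi> \<Delta> J m i = pos_roots \<Phi> \<Delta> - J (min i m)"

definition pos_geom_chain :: "'a::euclidean_space set \<Rightarrow> 'a set \<Rightarrow> (nat \<Rightarrow> 'a set) \<Rightarrow> nat \<Rightarrow> bool" where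
  "pos_geom_chain \<Phi> \<Delta> J m \<longleftrightarrow>
     J 0 = {} \<and> (\<forall>i<m. J i \<subseteq> J (Suc i)) \<and> (\<forall>i\<le>m. root_ideal \<Phi> \<Delta> (J i))
     \<and> (\<forall>i j. i + j \<le> m \<longrightarrow> setsum (J i) (J j) \<inter> pos_roots \<Phi> \<Delta> \<subseteq> J (i + j))
     \<and> (\<forall>i j. setsum (co_chain \<Phi> \<Delta> J m i) (co_chain \<Phi> \<Delta> J m j) \<inter> pos_roots \<Phi> \<Delta>
                \<subseteq> co_chain \<Phi> \<Delta> J m (i + j))
     \<and> \<Delta> \<subseteq> J m"

definition region_of :: "'a::euclidean_space set \<Rightarrow> 'a set \<Rightarrow> (nat \<Rightarrow> 'a set) \<Rightarrow> nat \<Rightarrow> 'a set" where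
  "region_of \<Phi> \<Delta> J m = {x. \<forall>r\<le>m.
      (\<forall>\<alpha>\<in>co_chain \<Phi> \<Delta> J m r. \<alpha> \<bullet> x > real r) \<and>
      (\<forall>\<alpha>\<in>J r. 0 < \<alpha> \<bullet> x \<and> \<alpha> \<bullet> x < real r)}"

text \<open>r_alpha(J): minimum of r_1 + ... + r_k over decompositions alpha = alpha_1 + ... + alpha_k
  with alpha_i in J_{r_i} (k >= 1, 0 <= r_i <= m). A decomposition is a nonempty list of pairs
  (alpha_i, r_i).\<close>
definition rank_J :: "(nat \<Rightarrow> 'a::euclidean_space set) \<Rightarrow> nat \<Rightarrow> 'a \<Rightarrow> nat" where
  "rank_J J m \<alpha> = Inf {sum_list (map snd ds) | ds. ds \<noteq> [] \<and>
       (\<forall>p\<in>set ds. snd p \<le> m \<and> fst p \<in> J (snd p)) \<and> sum_list (map fst ds) = \<alpha>}"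

definition indecomposable :: "'a::euclidean_space set \<Rightarrow> 'a set \<Rightarrow> (nat \<Rightarrow> 'a set) \<Rightarrow> nat \<Rightarrow> nat \<Rightarrow> 'a \<Rightarrow> bool" where
  "indecomposable \<Phi> \<Delta> J m r \<alpha> \<longleftrightarrow>
     1 \<le> r \<and> r \<le> m \<and> \<alpha> \<in> pos_roots \<Phi> \<Delta> \<and> \<alpha> \<in> J r \<and> rank_J J m \<alpha> = r
     \<and> \<not> (\<exists>\<beta> \<gamma> i j. 1 \<le> i \<and> 1 \<le> j \<and> i + j = r \<and> \<beta> \<in> J i \<and> \<gamma> \<in> J j \<and> \<alpha> = \<beta> + \<gamma>)
     \<and> (\<forall>\<beta>\<in>pos_roots \<Phi> \<Delta>. \<alpha> + \<beta> \<in> pos_roots \<Phi> \<Delta> \<longrightarrow>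
          (\<forall>t. rank_J J m (\<alpha> + \<beta>) = t \<and> t \<le> m \<longrightarrow> \<beta> \<in> J (t - r)))"

end

theory Submission
  imports Defs
begin

text \<open>
  Extend \<open>r\<^sub>\<alpha> = r\<^sub>\<alpha>(J)\<close> to all roots by \<open>f(\<alpha>) = r\<^sub>\<alpha>\<close> and \<open>f(-\<alpha>) = 1 - r\<^sub>\<alpha>\<close> for positive
  \<open>\<alpha>\<close>. Then \<open>f(\<alpha>) + f(-\<alpha>) = 1\<close>, and comparing two decompositions of one root through inner products
  shows that \<open>f\<close> is subadditive. By a theorem of Shi, proved here by minimising a maximum of affine
  functions, the inequalities \<open>(\<alpha>, x) < f(\<alpha>)\<close>, \<open>\<alpha> \<in> \<Phi>\<close>, then have a solution, so they define an
  alcove, namely \<open>w\<^sub>R A\<^sub>\<circ> \<subseteq> R\<close>. The inequality for \<open>\<alpha>\<close> defines a wall iff \<open>\<alpha>\<close> has no tight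
  decomposition \<open>\<alpha> = \<beta> + \<gamma>\<close>, \<open>f(\<alpha>) = f(\<beta>) + f(\<gamma>)\<close>, with \<open>\<beta>, \<gamma> \<in> \<Phi>\<close>: a tight decomposition puts
  the face into a second hyperplane, and without one raising \<open>f(\<alpha>)\<close> by one again gives an alcove,
  the neighbour across \<open>H\<^sub>\<alpha>\<close>. Indecomposability excludes the tight decompositions whose members have
  rank at most \<open>m\<close>, which are the ones visible in \<open>R\<close>, and an induction on height shows that this
  excludes all of them.
\<close>

section \<open>Subadditive functions on a root system and alcoves\<close>

lemma sum_list_remove1:
  fixes x :: "'a::comm_monoid_add"
  assumes "x \<in> set xs"
  shows "sum_list xs = x + sum_list (remove1 x xs)"
  using sum_list_map_remove1[OF assms, of "\<lambda>x. x"] by simp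

lemma inner_sum_list:
  fixes a :: "'a::real_inner"
  shows "a \<bullet> sum_list xs = sum_list (map ((\<bullet>) a) xs)"
  by (induction xs) (auto simp: inner_add_right)

section \<open>Root systems: sums and differences of roots\<close>

locale root_sys =
  fixes \<Phi> :: "'a::euclidean_space set"
  assumes root_system: "root_system \<Phi>"
begin

lemma fin: "finite \<Phi>" and zero_notin: "0 \<notin> \<Phi>" and span_roots: "span \<Phi> = UNIV"
  using root_system by (simp_all only: root_system_def not_False_eq_True)

lemma reduced: "\<alpha> \<in> \<Phi> \<Longrightarrow> c *\<^sub>R \<alpha> \<in> \<Phi> \<Longrightarrow> c = 1 \<or> c = -1"
  using root_system unfolding root_system_def by metis

lemma refl_root: "\<alpha> \<in> \<Phi> \<Longrightarrow> \<beta> \<in> \<Phi> \<Longrightarrow> refl_aff \<alpha> 0 \<beta> \<in> \<Phi>"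
  and cartan_int: "\<alpha> \<in> \<Phi> \<Longrightarrow> \<beta> \<in> \<Phi> \<Longrightarrow> 2 * (\<alpha> \<bullet> \<beta>) / (\<alpha> \<bullet> \<alpha>) \<in> \<int>"
  using root_system by (simp_all add: root_system_def)

lemma root_norm_pos: "\<alpha> \<in> \<Phi> \<Longrightarrow> 0 < \<alpha> \<bullet> \<alpha>"
  using zero_notin by (auto simp: inner_gt_zero_iff)

lemma uminus_root: "\<alpha> \<in> \<Phi> \<Longrightarrow> - \<alpha> \<in> \<Phi>"
  using refl_root[of \<alpha> \<alpha>] root_norm_pos[of \<alpha>] by (simp add: refl_aff_def scaleR_2)

lemma uminus_root_iff [simp]: "- \<alpha> \<in> \<Phi> \<longleftrightarrow> \<alpha> \<in> \<Phi>"
  using uminus_root[of \<alpha>] uminus_root[of "- \<alpha>"] by auto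

text \<open>Both Cartan integers \<open>n\<close> and \<open>k\<close> are negative. If one of them
  is -1, the corresponding reflection sends one of the roots to the sum; if both are at most -2,
  then \<open>\<alpha> + \<beta>\<close> has norm zero.\<close>

lemma add_root_if_inner_neg:
  assumes a: "\<alpha> \<in> \<Phi>" and b: "\<beta> \<in> \<Phi>" and neg: "\<alpha> \<bullet> \<beta> < 0"
  shows "\<alpha> + \<beta> \<in> \<Phi> \<or> \<alpha> + \<beta> = 0"
proof -
  have pa: "0 < \<alpha> \<bullet> \<alpha>" and pb: "0 < \<beta> \<bullet> \<beta>" using a b root_norm_pos by auto
  obtain n where n: "2 * (\<alpha> \<bullet> \<beta>) / (\<alpha> \<bullet> \<alpha>) = of_int n" using cartan_int[OF a b] by (auto elim: Ints_cases)
  obtain k where k: "2 * (\<alpha> \<bullet> \<beta>) / (\<beta> \<bullet> \<beta>) = of_int k"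
    using cartan_int[OF b a] by (auto elim: Ints_cases simp: inner_commute)
  have n': "2 * (\<alpha> \<bullet> \<beta>) = of_int n * (\<alpha> \<bullet> \<alpha>)" and k': "2 * (\<alpha> \<bullet> \<beta>) = of_int k * (\<beta> \<bullet> \<beta>)"
    using n k pa pb by (auto simp: field_simps)
  have nneg: "n < 0" and kneg: "k < 0"
    using n' k' neg pa pb by (smt (verit) of_int_0_le_iff mult_nonneg_nonneg)+
  consider "n = -1" | "k = -1" | "n \<le> -2" "k \<le> -2" using nneg kneg by linarith
  then show ?thesis
  proof cases
    case 1
    have "refl_aff \<alpha> 0 \<beta> = \<alpha> + \<beta>" using n 1 by (simp add: refl_aff_def)
    then show ?thesis using refl_root[OF a b] by simp
  next
    case 2
    have "refl_aff \<beta> 0 \<alpha> = \<alpha> + \<beta>" using k 2 by (simp add: refl_aff_def inner_commute)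
    then show ?thesis using refl_root[OF b a] by simp
  next
    case 3
    have "of_int n * (\<alpha> \<bullet> \<alpha>) \<le> -2 * (\<alpha> \<bullet> \<alpha>)" "of_int k * (\<beta> \<bullet> \<beta>) \<le> -2 * (\<beta> \<bullet> \<beta>)"
      using 3 pa pb by (intro mult_right_mono; simp)+
    then have "\<alpha> \<bullet> \<alpha> + \<alpha> \<bullet> \<beta> \<le> 0" "\<beta> \<bullet> \<beta> + \<alpha> \<bullet> \<beta> \<le> 0" using n' k' by linarith+
    then have "(\<alpha> + \<beta>) \<bullet> (\<alpha> + \<beta>) \<le> 0" by (simp add: inner_add_left inner_add_right inner_commute)
    then have "(\<alpha> + \<beta>) \<bullet> (\<alpha> + \<beta>) = 0" using inner_ge_zero[of "\<alpha> + \<beta>"] by linarith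
    then have "\<alpha> + \<beta> = 0" by (simp only: inner_eq_zero_iff)
    then show ?thesis by (rule disjI2)
  qed
qed

lemma diff_root_if_inner_pos:
  assumes "\<alpha> \<in> \<Phi>" and "\<beta> \<in> \<Phi>" and "0 < \<alpha> \<bullet> \<beta>"
  shows "\<alpha> - \<beta> \<in> \<Phi> \<or> \<alpha> = \<beta>"
proof -
  have "\<alpha> + - \<beta> \<in> \<Phi> \<or> \<alpha> + - \<beta> = 0"
    using add_root_if_inner_neg[of \<alpha> "- \<beta>"] assms by simp
  then show ?thesis by simp
qed

section \<open>Closed antisymmetric sets of roots lie in open half-spaces\<close>

definition closed_antisym :: "'a set \<Rightarrow> bool" where
  "closed_antisym P \<longleftrightarrow> P \<subseteq> \<Phi> \<and> (\<forall>a\<in>P. \<forall>b\<in>P. a + b \<in> \<Phi> \<longrightarrow> a + b \<in> P) \<and> (\<forall>a\<in>P. - a \<notin> P)"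

lemma closed_antisym_add:
  assumes "closed_antisym P" "a \<in> P" "b \<in> P" "a \<bullet> b < 0"
  shows "a + b \<in> P"
proof -
  have "a \<in> \<Phi>" "b \<in> \<Phi>" using assms by (auto simp: closed_antisym_def)
  then have "a + b \<in> \<Phi> \<or> a + b = 0" using add_root_if_inner_neg assms by blast
  moreover have "a + b \<noteq> 0" using assms by (auto simp: closed_antisym_def add_eq_0_iff)
  ultimately show ?thesis using assms by (auto simp: closed_antisym_def)
qed

text \<open>If the sum vanished, its first entry \<open>a\<close> would have negative inner product
  with a later entry \<open>b\<close>; replacing these two by \<open>a + b\<close>, again in
  \<open>P\<close>, gives a shorter vanishing sum.\<close>

lemma closed_antisym_sum_list_nonzero:
  assumes P: "closed_antisym P"
  shows "xs \<noteq> [] \<Longrightarrow> set xs \<subseteq> P \<Longrightarrow> sum_list xs \<noteq> 0"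
proof (induction "length xs" arbitrary: xs rule: less_induct)
  case less
  obtain a ys where xs: "xs = a # ys" using less.prems by (cases xs) auto
  have aP: "a \<in> P" using less.prems xs by auto
  have pos: "0 < a \<bullet> a" using aP P root_norm_pos by (auto simp: closed_antisym_def)
  show ?case
  proof
    assume z: "sum_list xs = 0"
    then have "a \<bullet> a + a \<bullet> sum_list ys = 0" using xs by (simp flip: inner_add_right)
    then have "sum_list (map ((\<bullet>) a) ys) < 0" using pos by (simp only: flip: inner_sum_list)
    then obtain b where b: "b \<in> set ys" "a \<bullet> b < 0"
      by (metis sum_list_nonneg imageE list.set_map not_less)
    let ?zs = "(a + b) # remove1 b ys"
    have "a + b \<in> P" using closed_antisym_add[OF P aP _ b(2)] less.prems xs b by auto
    moreover have "set (remove1 b ys) \<subseteq> P" using set_remove1_subset[of b ys] less.prems xs by auto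
    moreover have "length ?zs < length xs" using b xs length_pos_if_in_set[of b ys] by (auto simp: length_remove1)
    ultimately have "sum_list ?zs \<noteq> 0" using less.hyps by (metis insert_subset list.set(2) list.distinct(1))
    moreover have "sum_list ?zs = sum_list xs" using sum_list_remove1[OF b(1)] xs by (simp add: add.assoc)
    ultimately show False using z by simp
  qed
qed

text \<open>An element that is maximal for the order \<open>a < b\<close> iff \<open>b - a\<close> is a sum of elements of \<open>P\<close>
  cannot have a negative inner product with any element of \<open>P\<close>, as adding that element would enlarge it.\<close>

lemma closed_antisym_dominant:
  assumes P: "closed_antisym P" and ne: "P \<noteq> {}"
  shows "\<exists>g\<in>P. \<forall>a\<in>P. 0 \<le> g \<bullet> a"
proof -
  define R where "R = (\<lambda>a b. \<exists>xs. xs \<noteq> [] \<and> set xs \<subseteq> P \<and> b = a + sum_list xs)"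
  have finP: "finite P" using P fin by (auto simp: closed_antisym_def intro: finite_subset)
  have irr: "\<not> R a a" for a
    using closed_antisym_sum_list_nonzero[OF P] by (auto simp: R_def)
  have tr: "R a c" if "R a b" "R b c" for a b c
  proof -
    obtain xs ys where "xs \<noteq> []" "set xs \<subseteq> P" "b = a + sum_list xs"
      "ys \<noteq> []" "set ys \<subseteq> P" "c = b + sum_list ys" using \<open>R a b\<close> \<open>R b c\<close> unfolding R_def by blast
    then have "xs @ ys \<noteq> []" "set (xs @ ys) \<subseteq> P" "c = a + sum_list (xs @ ys)"
      by (auto simp: add.assoc)
    then show ?thesis unfolding R_def by blast
  qed
  have "asymp_on P R" by (rule asymp_onI) (use irr tr in blast)
  moreover have "transp_on P R" by (rule transp_onI) (use tr in blast)
  ultimately obtain g where g: "g \<in> P" "\<forall>x\<in>P. x \<noteq> g \<longrightarrow> \<not> R g x"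
    using Finite_Set.bex_max_element[OF finP _ _ ne, of R] by blast
  have "0 \<le> g \<bullet> a" if a: "a \<in> P" for a
  proof (rule ccontr)
    assume "\<not> 0 \<le> g \<bullet> a"
    then have s: "g + a \<in> P" using closed_antisym_add[OF P g(1) a] by auto
    have "R g (g + a)" unfolding R_def by (rule exI[of _ "[a]"]) (use a in auto)
    moreover have "g + a \<noteq> g" using a P zero_notin by (auto simp: closed_antisym_def)
    ultimately show False using g(2) s by auto
  qed
  then show ?thesis using g(1) by blast
qed

text \<open>Induction on the cardinality: \<open>g\<close> from
  \<open>closed_antisym_dominant\<close> is nonnegative on \<open>P\<close>, the elements of
  \<open>P\<close> orthogonal to \<open>g\<close> form a smaller closed antisymmetric set with a
  vector \<open>y\<close>, and \<open>g + e *\<^sub>R y\<close> works for all of \<open>P\<close>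
  once \<open>e\<close> is positive and small.\<close>

lemma closed_antisym_halfspace:
  assumes "closed_antisym P"
  shows "\<exists>y. \<forall>a\<in>P. 0 < a \<bullet> y"
  using assms
proof (induction "card P" arbitrary: P rule: less_induct)
  case less
  note P = less.prems
  have finP: "finite P" using P fin by (auto simp: closed_antisym_def intro: finite_subset)
  show ?case
  proof (cases "P = {}")
    case False
    then obtain g where g: "g \<in> P" "\<forall>a\<in>P. 0 \<le> g \<bullet> a" using closed_antisym_dominant[OF P] by blast
    let ?Q = "{a\<in>P. g \<bullet> a = 0}"
    have "g \<notin> ?Q" using g P root_norm_pos[of g] by (auto simp: closed_antisym_def)
    then have "?Q \<subset> P" using g(1) by blast
    then have "card ?Q < card P" using finP by (intro psubset_card_mono)
    moreover have "closed_antisym ?Q" using P by (auto simp: closed_antisym_def inner_add_right)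
    ultimately obtain y where y: "\<forall>a\<in>?Q. 0 < a \<bullet> y" using less.hyps by blast
    have "\<forall>\<^sub>F e in at_right (0::real). \<forall>a\<in>P. 0 < a \<bullet> (g + e *\<^sub>R y)"
    proof (rule eventually_ball_finite[OF finP], rule)
      fix a assume a: "a \<in> P"
      show "\<forall>\<^sub>F e in at_right (0::real). 0 < a \<bullet> (g + e *\<^sub>R y)"
      proof (cases "g \<bullet> a = 0")
        case True
        then have "0 < a \<bullet> y" using y a by auto
        then show ?thesis using True eventually_at_right_less[of 0]
          by (auto elim!: eventually_mono simp: inner_add_right inner_commute)
      next
        case False
        then have "0 < a \<bullet> g" using g a by (force simp: inner_commute)
        moreover have "((\<lambda>e. a \<bullet> (g + e *\<^sub>R y)) \<longlongrightarrow> a \<bullet> (g + 0 *\<^sub>R y)) (at_right 0)"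
          by (intro tendsto_intros)
        ultimately show ?thesis by (auto dest: order_tendstoD(1))
      qed
    qed
    then show ?thesis using eventually_happens[of _ "at_right (0::real)"] trivial_limit_at_right_real by blast
  qed auto
qed

section \<open>Shi functions and their alcoves\<close>

definition shi :: "('a \<Rightarrow> int) \<Rightarrow> bool" where
  "shi f \<longleftrightarrow> (\<forall>a\<in>\<Phi>. f (- a) = 1 - f a) \<and> (\<forall>a\<in>\<Phi>. \<forall>b\<in>\<Phi>. a + b \<in> \<Phi> \<longrightarrow> f (a + b) \<le> f a + f b)"

text \<open>For a \<open>shi\<close> function the upper bounds at \<open>a\<close> and
  \<open>- a\<close> together are the strip \<open>f a - 1 < a \<bullet> x < f a\<close>, so
  \<open>f\<close> plays the role of the numbers r(w, a). Conversely, a point in all strips gives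
  \<open>f (a + b) - 1 < f a + f b\<close>, which over the integers is subadditivity.\<close>

definition alcove :: "('a \<Rightarrow> int) \<Rightarrow> 'a set" where
  "alcove f = {x. \<forall>a\<in>\<Phi>. a \<bullet> x < of_int (f a)}"

text \<open>Upper bounds at \<open>a\<close> and \<open>- a\<close> bound the absolute value of
  \<open>a \<bullet> x\<close>; as the roots span, every coordinate is then bounded on
  \<open>K\<close>.\<close>

lemma bounded_if_inner_roots_bounded:
  assumes "\<And>a x. a \<in> \<Phi> \<Longrightarrow> x \<in> K \<Longrightarrow> a \<bullet> x \<le> M a"
  shows "bounded K"
proof -
  have "\<exists>B. \<forall>x\<in>K. \<bar>v \<bullet> x\<bar> \<le> B" for v
  proof -
    have "v \<in> span \<Phi>" using span_roots by simp
    then show ?thesis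
    proof (induction rule: span_induct_alt)
      case base then show ?case by (auto intro: exI[of _ 0])
    next
      case (step c a v)
      then obtain B where B: "\<forall>x\<in>K. \<bar>v \<bullet> x\<bar> \<le> B" by blast
      have "\<bar>(c *\<^sub>R a + v) \<bullet> x\<bar> \<le> \<bar>c\<bar> * (\<bar>M a\<bar> + \<bar>M (- a)\<bar>) + B" if x: "x \<in> K" for x
      proof -
        have "\<bar>a \<bullet> x\<bar> \<le> \<bar>M a\<bar> + \<bar>M (- a)\<bar>"
          using assms[OF step(1) x] assms[of "- a" x] step(1) x by auto
        then have "\<bar>c * (a \<bullet> x)\<bar> \<le> \<bar>c\<bar> * (\<bar>M a\<bar> + \<bar>M (- a)\<bar>)" by (simp add: abs_mult mult_left_mono)
        then show ?thesis using B x by (smt (verit) inner_add_left inner_scaleR_left)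
      qed
      then show ?case by blast
    qed
  qed
  then obtain B where B: "\<And>v x. x \<in> K \<Longrightarrow> \<bar>v \<bullet> x\<bar> \<le> B v" by metis
  have "norm x \<le> (\<Sum>b\<in>Basis. B b)" if "x \<in> K" for x
    using norm_le_l1[of x] sum_mono[of Basis "\<lambda>b. \<bar>x \<bullet> b\<bar>" B] B[OF that] by (force simp: inner_commute)
  then show ?thesis by (auto simp: bounded_iff)
qed

text \<open>Minimise \<open>v\<close> subject to \<open>a \<bullet> x \<le> f a + v\<close> for all roots \<open>a\<close>. If the minimum were nonnegative,
  the set of active roots would be closed and antisymmetric, hence contained in an open half-space,
  and moving \<open>x\<close> away from it would decrease \<open>v\<close>.\<close>

theorem alcove_nonempty:
  assumes f: "shi f"
  shows "alcove f \<noteq> {}"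
proof -
  \<comment> \<open>The pairs in \<open>C\<close> are (x, v). The value \<open>v0\<close> is large
    enough for (0, v0) to be feasible; together with the lower bound -1 it makes \<open>D\<close>
    compact. That lower bound does no harm, since only the sign of the minimal v matters.\<close>
  define C where "C = {p::'a \<times> real. -1 \<le> snd p \<and> (\<forall>a\<in>\<Phi>. a \<bullet> fst p \<le> of_int (f a) + snd p)}"
  define v0 where "v0 = Max (insert 0 ((\<lambda>a. - of_int (f a)) ` \<Phi>) :: real set)"
  define D where "D = C \<inter> {p. snd p \<le> v0}"
  have v0: "0 \<le> v0" "\<And>a. a \<in> \<Phi> \<Longrightarrow> 0 \<le> of_int (f a) + v0"
  proof -
    have "- of_int (f a) \<le> v0" if "a \<in> \<Phi>" for a
      unfolding v0_def using that fin by (intro Max_ge) auto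
    then show "\<And>a. a \<in> \<Phi> \<Longrightarrow> 0 \<le> of_int (f a) + v0" by force
  qed (auto simp: v0_def fin)
  have D0: "(0, v0) \<in> D" using v0 by (auto simp: D_def C_def)
  have "D = {p. -1 \<le> snd p} \<inter> (\<Inter>a\<in>\<Phi>. {p. a \<bullet> fst p \<le> of_int (f a) + snd p}) \<inter> {p. snd p \<le> v0}"
    by (auto simp: D_def C_def)
  then have "closed D"
    by (auto intro!: closed_Int closed_INT closed_Collect_le continuous_intros)
  moreover have "bounded D"
  proof -
    have "bounded (fst ` D)"
      by (rule bounded_if_inner_roots_bounded[where M = "\<lambda>a. of_int (f a) + v0"]) (force simp: D_def C_def)
    moreover have "bounded (snd ` D)"
      by (rule bounded_subset[of "{-1..v0}"]) (auto simp: D_def C_def)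
    ultimately show ?thesis
      by (rule bounded_subset[OF bounded_Times]) (auto simp: mem_Times_iff intro: image_eqI[of _ fst, OF fst_conv[symmetric]] image_eqI[of _ snd, OF snd_conv[symmetric]])
  qed
  ultimately have "compact D" by (simp only: compact_eq_bounded_closed)
  moreover have "D \<noteq> {}" using D0 by blast
  moreover have "continuous_on D snd" by (intro continuous_intros)
  ultimately obtain p where p: "p \<in> D" "\<And>q. q \<in> D \<Longrightarrow> snd p \<le> snd q"
    using continuous_attains_inf[of D snd] by blast
  obtain x v where xv: "p = (x, v)" by (cases p)
  have x: "a \<bullet> x \<le> of_int (f a) + v" if "a \<in> \<Phi>" for a using p(1) that by (auto simp: xv D_def C_def)
  have vmin: "v \<le> u" if "-1 \<le> u" "\<forall>a\<in>\<Phi>. a \<bullet> z \<le> of_int (f a) + u" for z u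
  proof (cases "u \<le> v0")
    case True
    then have "(z, u) \<in> D" using that by (simp add: D_def C_def)
    then show ?thesis using p(2) xv by fastforce
  next
    case False
    moreover have "v \<le> v0" using p(1) xv by (simp add: D_def)
    ultimately show ?thesis by linarith
  qed
  have "v < 0"
  proof (rule ccontr)
    assume "\<not> v < 0"
    then have v: "0 \<le> v" by simp
    define E where "E = {a\<in>\<Phi>. a \<bullet> x = of_int (f a) + v}"
    \<comment> \<open>If \<open>a\<close> and \<open>- a\<close> were both active, adding the
      equations would give 1 + 2v = 0. If \<open>a\<close>, \<open>b\<close> are active, then (a +
      b, x) = f a + f b + 2v is at least f(a + b) + v, so \<open>a + b\<close> is active as well.
      Both arguments use that v is nonnegative.\<close>
    have "closed_antisym E" unfolding closed_antisym_def
    proof (intro conjI ballI impI)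
      show "E \<subseteq> \<Phi>" by (auto simp: E_def)
      fix a assume a: "a \<in> E"
      have "f (- a) = 1 - f a" using f a by (auto simp: shi_def E_def)
      then show "- a \<notin> E" using a v by (auto simp: E_def)
      fix b assume b: "b \<in> E" and ab: "a + b \<in> \<Phi>"
      have "f (a + b) \<le> f a + f b" using f a b ab by (auto simp: shi_def E_def)
      then have "real_of_int (f (a + b)) \<le> of_int (f a) + of_int (f b)" by linarith
      then show "a + b \<in> E" using a b ab x[OF ab] v by (auto simp: E_def inner_add_left)
    qed
    then obtain y where y: "\<forall>a\<in>E. 0 < a \<bullet> y" using closed_antisym_halfspace by blast
    have "\<forall>\<^sub>F e in at_right (0::real). \<forall>a\<in>\<Phi>. a \<bullet> (x - e *\<^sub>R y) < of_int (f a) + v"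
    proof (rule eventually_ball_finite[OF fin], rule)
      fix a assume a: "a \<in> \<Phi>"
      show "\<forall>\<^sub>F e in at_right (0::real). a \<bullet> (x - e *\<^sub>R y) < of_int (f a) + v"
      proof (cases "a \<in> E")
        case True
        then have "0 < a \<bullet> y" using y by auto
        then show ?thesis using True eventually_at_right_less[of 0]
          by (auto elim!: eventually_mono simp: inner_diff_right E_def)
      next
        case False
        then have "a \<bullet> x < of_int (f a) + v" using x[OF a] a by (force simp: E_def)
        moreover have "((\<lambda>e. a \<bullet> (x - e *\<^sub>R y)) \<longlongrightarrow> a \<bullet> (x - 0 *\<^sub>R y)) (at_right 0)"
          by (intro tendsto_intros)
        ultimately show ?thesis by (auto dest: order_tendstoD(2))
      qed
    qed
    then obtain z where z: "\<forall>a\<in>\<Phi>. a \<bullet> z < of_int (f a) + v"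
      using eventually_happens[of _ "at_right (0::real)"] trivial_limit_at_right_real by blast
    have "\<forall>\<^sub>F u in at_left v. -1 \<le> u \<and> u < v \<and> (\<forall>a\<in>\<Phi>. a \<bullet> z \<le> of_int (f a) + u)"
    proof (intro eventually_conj eventually_ball_finite[OF fin] ballI)
      show "\<forall>\<^sub>F u in at_left v. -1 \<le> u" using eventually_at_left_field[of "\<lambda>u. -1 \<le> u" v] v
        by (auto intro!: exI[of _ "-1"])
      show "\<forall>\<^sub>F u in at_left v. u < v" by (auto simp: eventually_at_left_field intro: exI[of _ "v - 1"])
      fix a assume "a \<in> \<Phi>"
      then have "a \<bullet> z - of_int (f a) < v" using z by force
      then show "\<forall>\<^sub>F u in at_left v. a \<bullet> z \<le> of_int (f a) + u"
        by (auto simp: eventually_at_left_field intro!: exI[of _ "a \<bullet> z - of_int (f a)"])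
    qed
    then obtain u where "-1 \<le> u" "u < v" "\<forall>a\<in>\<Phi>. a \<bullet> z \<le> of_int (f a) + u"
      using eventually_happens[of _ "at_left v"] trivial_limit_at_left_real by blast
    then show False using vmin by force
  qed
  then have "x \<in> alcove f" using x by (force simp: alcove_def)
  then show ?thesis by blast
qed

lemma alcove_lower:
  assumes "shi f" "x \<in> alcove f" "a \<in> \<Phi>"
  shows "of_int (f a) - 1 < a \<bullet> x"
proof -
  have "f (- a) = 1 - f a" using assms by (auto simp: shi_def)
  moreover have "(- a) \<bullet> x < of_int (f (- a))"
    using assms(2,3) unfolding alcove_def by (metis (mono_tags, lifting) mem_Collect_eq uminus_root)
  ultimately show ?thesis by simp
qed

definition tight :: "('a \<Rightarrow> int) \<Rightarrow> 'a \<Rightarrow> bool" where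
  "tight f a \<longleftrightarrow> (\<exists>b\<in>\<Phi>. \<exists>c\<in>\<Phi>. a = b + c \<and> f a = f b + f c)"

text \<open>Raising \<open>f\<close> by one at \<open>a\<close> describes the alcove across the hyperplane; the segment from one
  alcove to the other crosses only that hyperplane.\<close>

lemma ex_point_on_one_hyperplane:
  assumes f: "shi f" and a: "a \<in> \<Phi>" and nt: "\<not> tight f a"
  shows "\<exists>x. a \<bullet> x = of_int (f a) \<and> (\<forall>b\<in>\<Phi>. b \<noteq> a \<longrightarrow> b \<bullet> x < of_int (f b))"
proof -
  \<comment> \<open>The value at \<open>- a\<close> has to drop along, so that g(-a) = 1 -
    g(a).\<close>
  define g where "g = f(a := f a + 1, - a := - f a)"
  have a0: "a \<noteq> - a"
  proof
    assume "a = - a"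
    then have "a \<bullet> a = - (a \<bullet> a)" by (metis inner_minus_right)
    then show False using root_norm_pos[OF a] by simp
  qed
  have fm: "f (- b) = 1 - f b" if "b \<in> \<Phi>" for b using f that by (auto simp: shi_def)
  have fs: "f (b + c) \<le> f b + f c" if "b \<in> \<Phi>" "c \<in> \<Phi>" "b + c \<in> \<Phi>" for b c using f that by (auto simp: shi_def)
  have ga: "g a = f a + 1" and gma: "g (- a) = - f a" using a0 by (auto simp: g_def)
  have go: "g b = f b" if "b \<noteq> a" "b \<noteq> - a" for b using that by (auto simp: g_def)
  \<comment> \<open>Raising the value of a summand is harmless as long as the sum and the other
    summand keep their values; being reduced excludes the multiples of \<open>a\<close> that would
    spoil this.\<close>
  have aa: "g (a + c) \<le> g a + g c" if c: "c \<in> \<Phi>" "a + c \<in> \<Phi>" for c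
  proof -
    have "c \<noteq> - a" using c zero_notin by auto
    moreover have "c \<noteq> a" using c reduced[OF a, of 2] by (auto simp: scaleR_2)
    moreover have "a + c \<noteq> a" using c zero_notin by auto
    moreover have "a + c \<noteq> - a"
    proof
      assume "a + c = - a"
      then have "c = (-2) *\<^sub>R a" by (simp add: scaleR_2 eq_neg_iff_add_eq_0 algebra_simps)
      then show False using c reduced[OF a, of "-2"] by auto
    qed
    ultimately show ?thesis using fs[OF a c] by (simp add: ga go)
  qed
  \<comment> \<open>The summand \<open>- a\<close> has lost one, so one unit has to be gained: a = c
    + (a - c) is not tight, hence subadditivity is strict there.\<close>
  have ma: "g (- a + c) \<le> g (- a) + g c" if c: "c \<in> \<Phi>" "- a + c \<in> \<Phi>" for c
  proof -
    have "c \<noteq> a" using c zero_notin by auto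
    moreover have "c \<noteq> - a"
    proof
      assume "c = - a"
      then have "- a + c = (-2) *\<^sub>R a" by (simp add: scaleR_2)
      then show False using c reduced[OF a, of "-2"] by auto
    qed
    moreover have "- a + c \<noteq> - a" using c zero_notin by auto
    moreover have "- a + c \<noteq> a"
    proof
      assume "- a + c = a"
      then have "c = 2 *\<^sub>R a" by (simp add: scaleR_2 algebra_simps)
      then show False using c reduced[OF a, of 2] by auto
    qed
    moreover have "f a < f c + f (- (- a + c))"
    proof -
      have r: "- (- a + c) \<in> \<Phi>" using c(2) by (simp only: uminus_root_iff)
      have e: "c + - (- a + c) = a" by simp
      have "f a \<le> f c + f (- (- a + c))" using fs[OF c(1) r] a e by simp
      moreover have "f a \<noteq> f c + f (- (- a + c))" using nt c(1) r e unfolding tight_def by metis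
      ultimately show ?thesis by simp
    qed
    ultimately show ?thesis using fm[OF c(2)] by (simp add: gma go)
  qed
  have "shi g" unfolding shi_def
  proof (intro conjI ballI impI)
    fix b assume b: "b \<in> \<Phi>"
    consider "b = a" | "b = - a" | "b \<noteq> a" "- b \<noteq> a" by fastforce
    then show "g (- b) = 1 - g b"
    proof cases
      case 3
      then have "- b \<noteq> - a" "b \<noteq> - a" by auto
      then show ?thesis using 3 go[of b] go[of "- b"] fm[OF b] by auto
    qed (auto simp: ga gma)
    fix c assume c: "c \<in> \<Phi>" and bc: "b + c \<in> \<Phi>"
    show "g (b + c) \<le> g b + g c"
    proof (cases "b \<in> {a, - a} \<or> c \<in> {a, - a}")
      case True
      then show ?thesis
        using aa[OF c] aa[OF b] ma[OF c] ma[OF b] bc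
        by (metis add.commute empty_iff insert_iff)
    next
      case False
      then have gbc: "g b = f b" "g c = f c" using go by auto
      have "f (b + c) \<le> f b + f c" using fs b c bc by auto
      \<comment> \<open>The only sum whose value goes up is \<open>a\<close> itself, and there
        non-tightness again leaves room for one unit.\<close>
      moreover have "f (b + c) \<noteq> f b + f c" if "b + c = a" using nt b c that unfolding tight_def by metis
      moreover have "g (b + c) \<le> f (b + c) + (if b + c = a then 1 else 0)"
        using ga gma go[of "b + c"] fm[OF a] by (cases "b + c = a"; cases "b + c = - a") auto
      ultimately show ?thesis using gbc by (auto split: if_splits)
    qed
  qed
  then obtain y where y: "y \<in> alcove g" using alcove_nonempty by blast
  obtain z where z: "z \<in> alcove f" using alcove_nonempty[OF f] by blast
  have ay: "of_int (f a) < a \<bullet> y" using alcove_lower[OF \<open>shi g\<close> y a] ga by simp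
  have az: "a \<bullet> z < of_int (f a)" using z a by (auto simp: alcove_def)
  \<comment> \<open>The parameter at which the segment from \<open>z\<close> to \<open>y\<close>
    meets the hyperplane of \<open>a\<close>. For every other root \<open>b\<close> both ends
    satisfy the bound \<open>f b\<close>, because \<open>g b \<le> f b\<close>.\<close>
  define t where "t = (of_int (f a) - a \<bullet> z) / (a \<bullet> y - a \<bullet> z)"
  have t: "0 < t" "t < 1" using ay az by (auto simp: t_def field_simps)
  define x where "x = z + t *\<^sub>R (y - z)"
  have tt: "t * (a \<bullet> y - a \<bullet> z) = of_int (f a) - a \<bullet> z" using ay az by (simp add: t_def)
  have "a \<bullet> x = of_int (f a)" using tt by (simp add: x_def inner_add_right inner_diff_right)
  moreover have "b \<bullet> x < of_int (f b)" if b: "b \<in> \<Phi>" "b \<noteq> a" for b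
  proof -
    have gb: "real_of_int (g b) \<le> of_int (f b)"
      using b gma go[of b] fm[OF a] by (cases "b = - a") auto
    have "b \<bullet> y < of_int (g b)" using y b by (auto simp: alcove_def)
    then have "t * (b \<bullet> y) < t * of_int (f b)" using gb t by simp
    moreover have "(1 - t) * (b \<bullet> z) < (1 - t) * of_int (f b)" using z b t by (auto simp: alcove_def)
    ultimately have "(1 - t) * (b \<bullet> z) + t * (b \<bullet> y) < of_int (f b)" by (simp add: algebra_simps)
    moreover have "b \<bullet> x = (1 - t) * (b \<bullet> z) + t * (b \<bullet> y)"
      by (simp add: x_def inner_add_right inner_diff_right algebra_simps)
    ultimately show ?thesis by simp
  qed
  ultimately show ?thesis by blast
qed

end

section \<open>Ranks with respect to a chain of ideals\<close>

lemma nonneg_comb_0: "nonneg_comb \<Delta> 0"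
  unfolding nonneg_comb_def by (rule exI[of _ "\<lambda>_. 0"]) simp

lemma nonneg_comb_add: "nonneg_comb \<Delta> u \<Longrightarrow> nonneg_comb \<Delta> v \<Longrightarrow> nonneg_comb \<Delta> (u + v)"
  unfolding nonneg_comb_def
proof (elim exE conjE)
  fix c d assume "\<forall>\<sigma>\<in>\<Delta>. 0 \<le> c \<sigma>" "\<forall>\<sigma>\<in>\<Delta>. 0 \<le> d \<sigma>" "u = (\<Sum>\<sigma>\<in>\<Delta>. c \<sigma> *\<^sub>R \<sigma>)" "v = (\<Sum>\<sigma>\<in>\<Delta>. d \<sigma> *\<^sub>R \<sigma>)"
  then show "\<exists>c. (\<forall>\<sigma>\<in>\<Delta>. 0 \<le> c \<sigma>) \<and> u + v = (\<Sum>\<sigma>\<in>\<Delta>. c \<sigma> *\<^sub>R \<sigma>)"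
    by (intro exI[of _ "\<lambda>\<sigma>. c \<sigma> + d \<sigma>"]) (simp add: scaleR_add_left sum.distrib)
qed

lemma nonneg_comb_sum_list: "(\<And>v. v \<in> set vs \<Longrightarrow> nonneg_comb \<Delta> v) \<Longrightarrow> nonneg_comb \<Delta> (sum_list vs)"
  by (induction vs) (auto simp: nonneg_comb_0 intro: nonneg_comb_add)

section \<open>Positive and simple roots\<close>

locale pos_root_sys = root_sys +
  fixes \<Delta> :: "'a set"
  assumes simple_system: "simple_system \<Phi> \<Delta>"
begin

abbreviation Pos :: "'a set" where "Pos \<equiv> pos_roots \<Phi> \<Delta>"

lemma fin_simple: "finite \<Delta>"
  using simple_system fin finite_subset unfolding simple_system_def by blast

lemma pos_root: "\<alpha> \<in> Pos \<Longrightarrow> \<alpha> \<in> \<Phi>"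
  by (simp add: pos_roots_def)

lemma pos_comb: "\<alpha> \<in> Pos \<Longrightarrow> nonneg_comb \<Delta> \<alpha>"
  by (simp add: pos_roots_def)

lemma fin_pos: "finite Pos"
  using fin by (simp add: pos_roots_def)

lemma simple_coeffs_zero:
  "(\<Sum>\<sigma>\<in>\<Delta>. c \<sigma> *\<^sub>R \<sigma>) = 0 \<Longrightarrow> \<sigma> \<in> \<Delta> \<Longrightarrow> c \<sigma> = 0"
  using simple_system fin_simple independentD[of \<Delta> \<Delta> c \<sigma>] by (simp add: simple_system_def)

lemma nonneg_comb_antisym:
  assumes "nonneg_comb \<Delta> v" "nonneg_comb \<Delta> (- v)"
  shows "v = 0"
proof -
  obtain c d where c: "\<forall>\<sigma>\<in>\<Delta>. 0 \<le> c \<sigma>" "v = (\<Sum>\<sigma>\<in>\<Delta>. c \<sigma> *\<^sub>R \<sigma>)"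
    and d: "\<forall>\<sigma>\<in>\<Delta>. 0 \<le> d \<sigma>" "- v = (\<Sum>\<sigma>\<in>\<Delta>. d \<sigma> *\<^sub>R \<sigma>)"
    using assms unfolding nonneg_comb_def by blast
  have "(\<Sum>\<sigma>\<in>\<Delta>. (c \<sigma> + d \<sigma>) *\<^sub>R \<sigma>) = v + - v"
    unfolding d(2) by (simp add: c(2) scaleR_add_left sum.distrib)
  then have "c \<sigma> + d \<sigma> = 0" if "\<sigma> \<in> \<Delta>" for \<sigma>
    using simple_coeffs_zero[of "\<lambda>\<sigma>. c \<sigma> + d \<sigma>"] that by simp
  then have "c \<sigma> = 0" if "\<sigma> \<in> \<Delta>" for \<sigma> using that c(1) d(1) by (metis add_nonneg_eq_0_iff)
  then show ?thesis by (simp add: c(2))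
qed

lemma pos_or_neg: "\<alpha> \<in> \<Phi> \<Longrightarrow> \<alpha> \<in> Pos \<or> - \<alpha> \<in> Pos"
  using simple_system by (auto simp: simple_system_def pos_roots_def)

lemma not_neg: "\<alpha> \<in> Pos \<Longrightarrow> - \<alpha> \<notin> Pos"
  using nonneg_comb_antisym[of \<alpha>] zero_notin by (auto simp: pos_roots_def)

lemma pos_add: "\<alpha> \<in> Pos \<Longrightarrow> \<beta> \<in> Pos \<Longrightarrow> \<alpha> + \<beta> \<in> \<Phi> \<Longrightarrow> \<alpha> + \<beta> \<in> Pos"
  using nonneg_comb_add[of \<Delta> \<alpha> \<beta>] by (simp add: pos_roots_def)

lemma closed_antisym_pos: "closed_antisym Pos"
  unfolding closed_antisym_def using pos_root pos_add not_neg by blast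

text \<open>Instead of the sum of the simple coefficients, any linear functional positive on the
  positive roots; one exists by \<open>closed_antisym_halfspace\<close>.\<close>

definition height :: "'a \<Rightarrow> real" where
  "height \<alpha> = \<alpha> \<bullet> (SOME y. \<forall>\<beta>\<in>Pos. 0 < \<beta> \<bullet> y)"

lemma height_pos:
  assumes "\<alpha> \<in> Pos"
  shows "0 < height \<alpha>"
proof -
  have "\<forall>\<beta>\<in>Pos. 0 < \<beta> \<bullet> (SOME y. \<forall>\<beta>\<in>Pos. 0 < \<beta> \<bullet> y)"
    by (rule someI_ex[OF closed_antisym_halfspace[OF closed_antisym_pos]])
  then show ?thesis using assms by (simp add: height_def)
qed

lemma height_add: "height (\<alpha> + \<beta>) = height \<alpha> + height \<beta>"
  by (simp add: height_def inner_add_left)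

text \<open>Heights are real numbers, so the induction runs over the number of positive roots of
  smaller height.\<close>

lemma pos_induct [consumes 1, case_names less]:
  assumes "\<alpha> \<in> Pos"
    and "\<And>\<alpha>. \<alpha> \<in> Pos \<Longrightarrow> (\<And>\<beta>. \<beta> \<in> Pos \<Longrightarrow> height \<beta> < height \<alpha> \<Longrightarrow> P \<beta>) \<Longrightarrow> P \<alpha>"
  shows "P \<alpha>"
  using assms(1)
proof (induction "card {\<beta>\<in>Pos. height \<beta> < height \<alpha>}" arbitrary: \<alpha> rule: less_induct)
  case less
  show ?case
  proof (rule assms(2)[OF less.prems])
    fix \<beta> assume b: "\<beta> \<in> Pos" "height \<beta> < height \<alpha>"
    have "{\<gamma>\<in>Pos. height \<gamma> < height \<beta>} \<subset> {\<gamma>\<in>Pos. height \<gamma> < height \<alpha>}" using b by force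
    then show "P \<beta>" using less.hyps b fin_pos by (simp add: psubset_card_mono)
  qed
qed

lemma simple_pos: "\<sigma> \<in> \<Delta> \<Longrightarrow> \<sigma> \<in> Pos"
proof -
  assume s: "\<sigma> \<in> \<Delta>"
  then have "(\<Sum>\<tau>\<in>\<Delta>. (if \<tau> = \<sigma> then 1 else 0) *\<^sub>R \<tau>) = (\<Sum>\<tau>\<in>\<Delta>. if \<tau> = \<sigma> then \<tau> else 0)"
    by (intro sum.cong) auto
  also have "\<dots> = \<sigma>" using s fin_simple by simp
  finally have "nonneg_comb \<Delta> \<sigma>" unfolding nonneg_comb_def
    by (intro exI[of _ "\<lambda>\<tau>. if \<tau> = \<sigma> then 1 else 0"]) auto
  then show ?thesis using s simple_system by (auto simp: pos_roots_def simple_system_def)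
qed

text \<open>By independence the nonnegative coefficients of \<open>\<alpha>\<close> and
  \<open>\<beta>\<close> at the simple roots other than \<open>\<sigma>\<close> cancel, hence
  vanish. So \<open>\<alpha>\<close> is a nonnegative multiple of \<open>\<sigma>\<close>, thus
  equal to it, and \<open>\<beta>\<close> is zero.\<close>

lemma simple_not_sum:
  assumes s: "\<sigma> \<in> \<Delta>" and a: "\<alpha> \<in> Pos" and b: "\<beta> \<in> Pos"
  shows "\<sigma> \<noteq> \<alpha> + \<beta>"
proof
  assume eq: "\<sigma> = \<alpha> + \<beta>"
  obtain c d where c: "\<forall>\<tau>\<in>\<Delta>. 0 \<le> c \<tau>" "\<alpha> = (\<Sum>\<tau>\<in>\<Delta>. c \<tau> *\<^sub>R \<tau>)"
    and d: "\<forall>\<tau>\<in>\<Delta>. 0 \<le> d \<tau>" "\<beta> = (\<Sum>\<tau>\<in>\<Delta>. d \<tau> *\<^sub>R \<tau>)"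
    using pos_comb[OF a] pos_comb[OF b] unfolding nonneg_comb_def by blast
  define e where "e = (\<lambda>\<tau>. if \<tau> = \<sigma> then 1 else (0::real))"
  have "(\<Sum>\<tau>\<in>\<Delta>. e \<tau> *\<^sub>R \<tau>) = (\<Sum>\<tau>\<in>\<Delta>. if \<tau> = \<sigma> then \<tau> else 0)"
    by (intro sum.cong) (auto simp: e_def)
  then have e: "(\<Sum>\<tau>\<in>\<Delta>. e \<tau> *\<^sub>R \<tau>) = \<sigma>" using s fin_simple by simp
  have "(\<Sum>\<tau>\<in>\<Delta>. (c \<tau> + d \<tau> - e \<tau>) *\<^sub>R \<tau>)
      = (\<Sum>\<tau>\<in>\<Delta>. c \<tau> *\<^sub>R \<tau>) + (\<Sum>\<tau>\<in>\<Delta>. d \<tau> *\<^sub>R \<tau>) - (\<Sum>\<tau>\<in>\<Delta>. e \<tau> *\<^sub>R \<tau>)"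
    by (simp add: scaleR_add_left scaleR_diff_left sum.distrib sum_subtractf)
  also have "\<dots> = 0" unfolding e using eq c(2) d(2) by simp
  finally have "c \<tau> + d \<tau> - e \<tau> = 0" if "\<tau> \<in> \<Delta>" for \<tau>
    using simple_coeffs_zero[of "\<lambda>\<tau>. c \<tau> + d \<tau> - e \<tau>"] that by simp
  then have "c \<tau> + d \<tau> = 0" if "\<tau> \<in> \<Delta>" "\<tau> \<noteq> \<sigma>" for \<tau>
    using that by (simp add: e_def)
  then have "c \<tau> = 0" if "\<tau> \<in> \<Delta>" "\<tau> \<noteq> \<sigma>" for \<tau>
    using that c(1) d(1) by (metis add_nonneg_eq_0_iff)
  then have "(\<Sum>\<tau>\<in>\<Delta>. c \<tau> *\<^sub>R \<tau>) = (\<Sum>\<tau>\<in>\<Delta>. if \<tau> = \<sigma> then c \<sigma> *\<^sub>R \<sigma> else 0)"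
    by (intro sum.cong) auto
  then have "\<alpha> = c \<sigma> *\<^sub>R \<sigma>" using c(2) s fin_simple by simp
  moreover have "0 \<le> c \<sigma>" using c(1) s by blast
  ultimately have "\<alpha> = \<sigma>"
    using reduced[of \<sigma> "c \<sigma>"] pos_root[OF a] pos_root[OF simple_pos[OF s]] by auto
  then have "\<beta> = 0" using eq by simp
  then show False using pos_root[OF b] zero_notin by simp
qed

text \<open>Recovers the integrality of the simple coefficients, which \<open>nonneg_comb\<close>
  leaves real. Some simple \<open>\<sigma>\<close> has positive inner product with
  \<open>\<alpha>\<close>; if \<open>\<alpha> - \<sigma>\<close> is not zero it is a root, and a
  negative one would make \<open>\<sigma>\<close> a sum of two positive roots.\<close>

lemma pos_is_sum_of_simple:
  assumes "\<alpha> \<in> Pos"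
  shows "\<exists>vs. vs \<noteq> [] \<and> set vs \<subseteq> \<Delta> \<and> sum_list vs = \<alpha>"
  using assms
proof (induction rule: pos_induct)
  case (less \<alpha>)
  obtain c where c: "\<forall>\<tau>\<in>\<Delta>. 0 \<le> c \<tau>" "\<alpha> = (\<Sum>\<tau>\<in>\<Delta>. c \<tau> *\<^sub>R \<tau>)"
    using pos_comb[OF less(1)] unfolding nonneg_comb_def by blast
  have "0 < \<alpha> \<bullet> \<alpha>" using less(1) pos_root root_norm_pos by blast
  then have "0 < (\<Sum>\<tau>\<in>\<Delta>. c \<tau> * (\<alpha> \<bullet> \<tau>))" by (subst (asm) (2) c(2)) (simp add: inner_sum_right)
  then obtain \<sigma> where s: "\<sigma> \<in> \<Delta>" "0 < c \<sigma> * (\<alpha> \<bullet> \<sigma>)" by (meson sum_nonpos not_less)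
  then have pos: "0 < \<alpha> \<bullet> \<sigma>" using c(1) by (metis zero_less_mult_pos mult_nonneg_nonpos not_less order.order_iff_strict mult_eq_0_iff less_irrefl)
  show ?case
  proof (cases "\<alpha> = \<sigma>")
    case True
    then show ?thesis using s by (intro exI[of _ "[\<sigma>]"]) auto
  next
    case False
    then have root: "\<alpha> - \<sigma> \<in> \<Phi>"
      using diff_root_if_inner_pos[OF pos_root[OF less(1)] pos_root[OF simple_pos[OF s(1)]] pos] by blast
    have "- (\<alpha> - \<sigma>) \<notin> Pos" using simple_not_sum[OF s(1) less(1), of "- (\<alpha> - \<sigma>)"] by auto
    then have p: "\<alpha> - \<sigma> \<in> Pos" using pos_or_neg[OF root] by blast
    have "height (\<alpha> - \<sigma>) < height \<alpha>"
      using height_add[of "\<alpha> - \<sigma>" \<sigma>] height_pos[OF simple_pos[OF s(1)]] by simp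
    then obtain vs where "vs \<noteq> []" "set vs \<subseteq> \<Delta>" "sum_list vs = \<alpha> - \<sigma>" using less(2) p by blast
    then show ?thesis using s(1) by (intro exI[of _ "\<sigma> # vs"]) auto
  qed
qed

text \<open>The product of the two expressions for the root is positive, so one of its four terms
  is; a positive term makes a difference of roots a root, and
  \<open>\<gamma> - \<beta> = \<alpha> - \<delta>\<close> brings the terms with
  \<open>\<beta>\<close> back to \<open>\<alpha>\<close>.\<close>

lemma two_decompositions:
  assumes "\<alpha> \<in> \<Phi>" "\<beta> \<in> \<Phi>" "\<gamma> \<in> \<Phi>" "\<delta> \<in> \<Phi>" "\<alpha> + \<beta> \<in> \<Phi>" and eq: "\<alpha> + \<beta> = \<gamma> + \<delta>"
  shows "\<alpha> = \<gamma> \<or> \<alpha> = \<delta> \<or> \<alpha> - \<gamma> \<in> \<Phi> \<or> \<alpha> - \<delta> \<in> \<Phi>"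
proof -
  have "0 < (\<alpha> + \<beta>) \<bullet> (\<gamma> + \<delta>)" using root_norm_pos[OF assms(5)] eq by simp
  then consider "0 < \<alpha> \<bullet> \<gamma>" | "0 < \<alpha> \<bullet> \<delta>" | "0 < \<gamma> \<bullet> \<beta>" | "0 < \<delta> \<bullet> \<beta>"
    by (simp only: inner_add_left inner_add_right inner_commute[of \<gamma> \<beta>] inner_commute[of \<delta> \<beta>]) linarith
  then show ?thesis
  proof cases
    case 3
    have "\<gamma> - \<beta> = \<alpha> - \<delta>" using eq by (simp add: algebra_simps)
    then show ?thesis using diff_root_if_inner_pos[OF assms(3,2) 3] eq by auto
  next
    case 4
    have "\<delta> - \<beta> = \<alpha> - \<gamma>" using eq by (simp add: algebra_simps)
    then show ?thesis using diff_root_if_inner_pos[OF assms(4,2) 4] eq by auto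
  qed (use diff_root_if_inner_pos assms in blast)+
qed

end

section \<open>Ranks of positive roots\<close>

locale ideal_chain = pos_root_sys +
  fixes J :: "nat \<Rightarrow> 'a set" and m :: nat
  assumes chain: "pos_geom_chain \<Phi> \<Delta> J m"
begin

abbreviation rk :: "'a \<Rightarrow> nat" where "rk \<equiv> rank_J J m"

lemma J_0: "J 0 = {}" and simple_in_J: "\<Delta> \<subseteq> J m"
  using chain by (auto simp: pos_geom_chain_def)

lemma J_mono: "i \<le> j \<Longrightarrow> j \<le> m \<Longrightarrow> J i \<subseteq> J j"
proof (induction j rule: dec_induct)
  case (step n)
  then have "J n \<subseteq> J (Suc n)" using chain by (auto simp: pos_geom_chain_def)
  then show ?case using step by auto
qed auto

lemma J_pos: "i \<le> m \<Longrightarrow> \<alpha> \<in> J i \<Longrightarrow> \<alpha> \<in> Pos"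
  using chain by (auto simp: pos_geom_chain_def root_ideal_def)

lemma J_down:
  assumes "i \<le> m" "\<alpha> + \<beta> \<in> J i" "\<alpha> \<in> Pos" "\<beta> \<in> Pos"
  shows "\<alpha> \<in> J i"
proof -
  have "root_le \<Delta> \<alpha> (\<alpha> + \<beta>)" using pos_comb[OF assms(4)] by (simp add: root_le_def)
  moreover have "root_ideal \<Phi> \<Delta> (J i)" using chain assms(1) by (auto simp: pos_geom_chain_def)
  ultimately show ?thesis using assms unfolding root_ideal_def by blast
qed

lemma J_add:
  assumes "i + j \<le> m" "\<alpha> \<in> J i" "\<beta> \<in> J j" "\<alpha> + \<beta> \<in> Pos"
  shows "\<alpha> + \<beta> \<in> J (i + j)"
proof -
  have "setsum (J i) (J j) \<inter> Pos \<subseteq> J (i + j)" using chain assms(1) by (auto simp: pos_geom_chain_def)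
  then show ?thesis using assms unfolding setsum_def by blast
qed

lemma co_J_add:
  assumes "\<alpha> \<in> Pos - J (min i m)" "\<beta> \<in> Pos - J (min j m)" "\<alpha> + \<beta> \<in> Pos"
  shows "\<alpha> + \<beta> \<notin> J (min (i + j) m)"
proof -
  have "setsum (co_chain \<Phi> \<Delta> J m i) (co_chain \<Phi> \<Delta> J m j) \<inter> Pos \<subseteq> co_chain \<Phi> \<Delta> J m (i + j)"
    using chain by (simp add: pos_geom_chain_def)
  then show ?thesis using assms unfolding setsum_def co_chain_def by blast
qed

definition decomposition :: "'a \<Rightarrow> ('a \<times> nat) list \<Rightarrow> bool" where
  "decomposition \<alpha> ds \<longleftrightarrow> ds \<noteq> [] \<and> (\<forall>p\<in>set ds. snd p \<le> m \<and> fst p \<in> J (snd p)) \<and> sum_list (map fst ds) = \<alpha>"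

lemma rk_eq: "rk \<alpha> = Inf {sum_list (map snd ds) | ds. decomposition \<alpha> ds}"
  unfolding rank_J_def decomposition_def by simp

lemma rk_le: "decomposition \<alpha> ds \<Longrightarrow> rk \<alpha> \<le> sum_list (map snd ds)"
  unfolding rk_eq by (rule cInf_lower) auto

lemma rk_le_if_in_J: "i \<le> m \<Longrightarrow> \<alpha> \<in> J i \<Longrightarrow> rk \<alpha> \<le> i"
  using rk_le[of \<alpha> "[(\<alpha>, i)]"] by (simp add: decomposition_def)

text \<open>The infimum is a minimum because decompositions exist: a positive root is a sum of
  simple roots, each of which can be labelled \<open>m\<close>.\<close>

lemma rk_attained:
  assumes "\<alpha> \<in> Pos"
  shows "\<exists>ds. decomposition \<alpha> ds \<and> sum_list (map snd ds) = rk \<alpha>"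
proof -
  obtain vs where vs: "vs \<noteq> []" "set vs \<subseteq> \<Delta>" "sum_list vs = \<alpha>" using pos_is_sum_of_simple[OF assms] by blast
  have "decomposition \<alpha> (map (\<lambda>v. (v, m)) vs)"
    using vs simple_in_J by (auto simp: decomposition_def comp_def)
  then have "{sum_list (map snd ds) | ds. decomposition \<alpha> ds} \<noteq> {}" by blast
  then have "rk \<alpha> \<in> {sum_list (map snd ds) | ds. decomposition \<alpha> ds}"
    unfolding rk_eq by (rule Inf_nat_def1)
  then show ?thesis by auto
qed

lemma rk_add_le:
  assumes "\<alpha> \<in> Pos" "\<beta> \<in> Pos"
  shows "rk (\<alpha> + \<beta>) \<le> rk \<alpha> + rk \<beta>"
proof -
  obtain ds es where "decomposition \<alpha> ds" "sum_list (map snd ds) = rk \<alpha>"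
    "decomposition \<beta> es" "sum_list (map snd es) = rk \<beta>" using rk_attained assms by metis
  then have "decomposition (\<alpha> + \<beta>) (ds @ es)" "sum_list (map snd (ds @ es)) = rk \<alpha> + rk \<beta>"
    by (auto simp: decomposition_def)
  then show ?thesis using rk_le by metis
qed

lemma rk_pos:
  assumes "\<alpha> \<in> Pos"
  shows "1 \<le> rk \<alpha>"
proof -
  obtain ds where ds: "decomposition \<alpha> ds" "sum_list (map snd ds) = rk \<alpha>" using rk_attained[OF assms] by blast
  then obtain p where p: "p \<in> set ds" "fst p \<in> J (snd p)"
    unfolding decomposition_def by (meson last_in_set)
  then have "snd p \<noteq> 0" using J_0 by (metis empty_iff)
  moreover have "snd p \<le> sum_list (map snd ds)" using p by (intro member_le_sum_list) auto
  ultimately show ?thesis using ds by simp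
qed

text \<open>In a minimal decomposition some part has positive inner product with
  \<open>\<alpha>\<close>. The remaining parts, if any, then add up to a root, which is positive as
  a sum of positive roots. Minimality forces the two ranks to add up exactly.\<close>

lemma rk_split:
  assumes a: "\<alpha> \<in> Pos"
  shows "(rk \<alpha> \<le> m \<and> \<alpha> \<in> J (rk \<alpha>)) \<or> (\<exists>\<beta>\<in>Pos. \<exists>\<gamma>\<in>Pos. \<alpha> = \<beta> + \<gamma> \<and> rk \<alpha> = rk \<beta> + rk \<gamma>)"
proof -
  obtain ds where ds: "decomposition \<alpha> ds" "sum_list (map snd ds) = rk \<alpha>" using rk_attained[OF a] by blast
  have elem: "fst p \<in> Pos" if "p \<in> set ds" for p using ds that J_pos by (auto simp: decomposition_def)
  have "\<alpha> \<bullet> sum_list (map fst ds) > 0" using ds root_norm_pos[OF pos_root[OF a]] by (simp add: decomposition_def)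
  then have "sum_list (map (\<lambda>p. \<alpha> \<bullet> fst p) ds) > 0" by (simp add: inner_sum_list comp_def)
  then obtain p where p: "p \<in> set ds" "0 < \<alpha> \<bullet> fst p"
    by (metis (mono_tags, lifting) imageE list.set_map not_less sum_list_nonpos)
  let ?es = "remove1 p ds"
  have sf: "\<alpha> = fst p + sum_list (map fst ?es)"
    using sum_list_map_remove1[OF p(1), of fst] ds by (simp add: decomposition_def)
  have ss: "rk \<alpha> = snd p + sum_list (map snd ?es)"
    using sum_list_map_remove1[OF p(1), of snd] ds by simp
  have pJ: "snd p \<le> m" "fst p \<in> J (snd p)" using ds p by (auto simp: decomposition_def)
  show ?thesis
  proof (cases "?es = []")
    case True
    then show ?thesis using sf ss pJ by simp
  next
    case False
    let ?b = "sum_list (map fst ?es)"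
    have sub: "set ?es \<subseteq> set ds" by (rule set_remove1_subset)
    then have es: "decomposition ?b ?es" using False ds(1) by (auto simp: decomposition_def)
    have esP: "q \<in> Pos" if "q \<in> set (map fst ?es)" for q
      using that elem sub by auto
    have "?b \<noteq> 0"
      using False esP by (intro closed_antisym_sum_list_nonzero[OF closed_antisym_pos]) auto
    then have "\<alpha> - fst p \<in> \<Phi>"
      using diff_root_if_inner_pos[OF pos_root[OF a] pos_root[OF elem[OF p(1)]] p(2)] sf by auto
    then have "?b \<in> \<Phi>" using sf by (metis add_diff_cancel_left')
    moreover have "nonneg_comb \<Delta> ?b" by (intro nonneg_comb_sum_list pos_comb esP)
    ultimately have bP: "?b \<in> Pos" by (simp add: pos_roots_def)
    have "rk \<alpha> \<le> rk (fst p) + rk ?b" using rk_add_le[OF elem[OF p(1)] bP] sf by simp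
    moreover have "rk ?b \<le> sum_list (map snd ?es)" by (rule rk_le[OF es])
    moreover have "rk (fst p) \<le> snd p" using rk_le_if_in_J pJ by blast
    ultimately have "rk \<alpha> = rk (fst p) + rk ?b" using ss by linarith
    then show ?thesis using sf elem[OF p(1)] bP by blast
  qed
qed

text \<open>The splitting of \<open>rk_split\<close> is iterated down to members of the ideals;
  every intermediate sum is a root, so \<open>J_add\<close> reassembles them.\<close>

lemma in_J_rk:
  assumes "\<alpha> \<in> Pos" "rk \<alpha> \<le> m"
  shows "\<alpha> \<in> J (rk \<alpha>)"
  using assms
proof (induction rule: pos_induct)
  case (less \<alpha>)
  consider "\<alpha> \<in> J (rk \<alpha>)" | \<beta> \<gamma> where "\<beta> \<in> Pos" "\<gamma> \<in> Pos" "\<alpha> = \<beta> + \<gamma>" "rk \<alpha> = rk \<beta> + rk \<gamma>"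
    using rk_split[OF less(1)] by blast
  then show ?case
  proof cases
    case 2
    have "height \<beta> < height \<alpha>" "height \<gamma> < height \<alpha>" using 2 height_add height_pos by auto
    then have "\<beta> \<in> J (rk \<beta>)" "\<gamma> \<in> J (rk \<gamma>)" using 2 less by auto
    then show ?thesis using 2 J_add less by metis
  qed
qed

lemma in_J_iff: "\<alpha> \<in> Pos \<Longrightarrow> i \<le> m \<Longrightarrow> \<alpha> \<in> J i \<longleftrightarrow> rk \<alpha> \<le> i"
  using rk_le_if_in_J[of i \<alpha>] in_J_rk[of \<alpha>] J_mono[of "rk \<alpha>" i] by auto

lemma pos_or_neg_cases:
  assumes "\<epsilon> \<in> \<Phi>"
  obtains "\<epsilon> \<in> Pos" | \<eta> where "\<eta> \<in> Pos" "\<epsilon> = - \<eta>"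
  using pos_or_neg[OF assms] by (metis minus_minus)

text \<open>If \<open>\<gamma>\<close> lies in the ideal of its rank, this is the additivity
  condition on the complements. Otherwise a rank-additive splitting of \<open>\<gamma>\<close> is
  compared with \<open>\<alpha> + \<beta>\<close> by \<open>two_decompositions\<close>, and the
  claim follows from \<open>rk_add_le\<close> and the induction hypothesis for one of the two
  members.\<close>

lemma rk_add_ge:
  assumes "\<gamma> \<in> Pos" "\<alpha> \<in> Pos" "\<beta> \<in> Pos" "\<gamma> = \<alpha> + \<beta>"
  shows "rk \<alpha> + rk \<beta> \<le> rk \<gamma> + 1"
  using assms
proof (induction arbitrary: \<alpha> \<beta> rule: pos_induct)
  case (less \<gamma>)
  note a = less.prems(1) and b = less.prems(2) and g = less.prems(3)
  consider (J) "rk \<gamma> \<le> m" "\<gamma> \<in> J (rk \<gamma>)"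
    | (split) \<gamma>' \<delta> where "\<gamma>' \<in> Pos" "\<delta> \<in> Pos" "\<gamma> = \<gamma>' + \<delta>" "rk \<gamma> = rk \<gamma>' + rk \<delta>"
    using rk_split[OF less.hyps] by blast
  then show ?case
  proof cases
    case J
    have "\<alpha> \<in> J (rk \<gamma>)" "\<beta> \<in> J (rk \<gamma>)"
      using J_down[OF J(1) _ a b] J_down[OF J(1) _ b a] J g by (auto simp: add.commute)
    then have le: "rk \<alpha> \<le> rk \<gamma>" "rk \<beta> \<le> rk \<gamma>" using J rk_le_if_in_J by auto
    have ge: "1 \<le> rk \<alpha>" "1 \<le> rk \<beta>" using a b rk_pos by auto
    \<comment> \<open>One below its rank a root is still outside the ideal, so the sum is outside
      the ideal of index \<open>rk \<alpha> + rk \<beta> - 2\<close>; the cut at \<open>m\<close>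
      does not interfere since \<open>rk \<gamma> \<le> m\<close>.\<close>
    have "\<alpha> \<notin> J (min (rk \<alpha> - 1) m)" "\<beta> \<notin> J (min (rk \<beta> - 1) m)"
      using in_J_iff[OF a, of "min (rk \<alpha> - 1) m"] in_J_iff[OF b, of "min (rk \<beta> - 1) m"] ge by auto
    then have "\<gamma> \<notin> J (min (rk \<alpha> - 1 + (rk \<beta> - 1)) m)"
      using co_J_add[of \<alpha> "rk \<alpha> - 1" \<beta> "rk \<beta> - 1"] a b g less.hyps by auto
    then have "\<not> rk \<gamma> \<le> min (rk \<alpha> - 1 + (rk \<beta> - 1)) m" using in_J_iff[OF less.hyps] by auto
    then show ?thesis using J ge by auto
  next
    case split
    \<comment> \<open>Treats one member \<open>\<delta>\<close> of the splitting; the other is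
      covered by exchanging \<open>\<gamma>'\<close> and \<open>\<delta>\<close>.\<close>
    have step: "rk \<alpha> + rk \<beta> \<le> rk \<gamma> + 1"
      if d: "\<delta> \<in> Pos" "\<gamma>' \<in> Pos" "\<gamma> = \<gamma>' + \<delta>" "rk \<gamma> = rk \<gamma>' + rk \<delta>" and e: "\<alpha> - \<delta> \<in> \<Phi>" for \<gamma>' \<delta>
    proof -
      have h: "height \<gamma>' < height \<gamma>" "height \<delta> < height \<gamma>" using d height_add height_pos by auto
      from e show ?thesis
      proof (cases rule: pos_or_neg_cases)
        case 1
        have eq: "\<alpha> = \<delta> + (\<alpha> - \<delta>)" "\<gamma>' = \<beta> + (\<alpha> - \<delta>)" using d g by (auto simp: algebra_simps)
        then have "rk \<alpha> \<le> rk \<delta> + rk (\<alpha> - \<delta>)" using rk_add_le[OF d(1) 1] by simp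
        moreover have "rk \<beta> + rk (\<alpha> - \<delta>) \<le> rk \<gamma>' + 1" using less.IH[OF d(2) h(1) b 1 eq(2)] .
        ultimately show ?thesis using d by linarith
      next
        case (2 \<eta>)
        have eq: "\<delta> = \<alpha> + \<eta>" "\<beta> = \<gamma>' + \<eta>" using 2 d g by (auto simp: algebra_simps)
        then have "rk \<beta> \<le> rk \<gamma>' + rk \<eta>" using rk_add_le[OF d(2) 2(1)] by simp
        moreover have "rk \<alpha> + rk \<eta> \<le> rk \<delta> + 1" using less.IH[OF d(1) h(2) a 2(1) eq(1)] .
        ultimately show ?thesis using d by linarith
      qed
    qed
    have "\<alpha> = \<gamma>' \<or> \<alpha> = \<delta> \<or> \<alpha> - \<gamma>' \<in> \<Phi> \<or> \<alpha> - \<delta> \<in> \<Phi>"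
      using two_decompositions[of \<alpha> \<beta> \<gamma>' \<delta>] a b split g less.hyps pos_root by metis
    then consider "\<alpha> = \<gamma>'" | "\<alpha> = \<delta>" | "\<alpha> - \<gamma>' \<in> \<Phi>" | "\<alpha> - \<delta> \<in> \<Phi>" by blast
    then show ?thesis
    proof cases
      case 1
      then have "\<beta> = \<delta>" using g split by simp
      then show ?thesis using 1 split by simp
    next
      case 2
      then have "\<beta> = \<gamma>'" using g split by simp
      then show ?thesis using 2 split by simp
    next
      case 3
      then show ?thesis using step[of \<gamma>' \<delta>] split by (simp add: add.commute)
    next
      case 4
      then show ?thesis using step[of \<delta> \<gamma>'] split by simp
    qed
  qed
qed

text \<open>Carries the bound from sums of rank at most \<open>m\<close> to all sums, by the
  comparison used for \<open>rk_add_ge\<close>. The unit by which it improves comes from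
  \<open>indec\<close>, which makes
  \<open>rk \<alpha> < rk \<delta> + rk (\<alpha> - \<delta>)\<close> strict, or from the induction
  hypothesis for \<open>\<delta> = \<alpha> + \<eta>\<close>.\<close>

lemma rk_add_exact:
  assumes "\<gamma> \<in> Pos" "\<alpha> \<in> Pos" "\<beta> \<in> Pos" "\<gamma> = \<alpha> + \<beta>"
    and indec: "\<And>\<mu> \<nu>. \<mu> \<in> Pos \<Longrightarrow> \<nu> \<in> Pos \<Longrightarrow> \<alpha> = \<mu> + \<nu> \<Longrightarrow> rk \<alpha> \<noteq> rk \<mu> + rk \<nu>"
    and low: "\<And>\<beta>. \<beta> \<in> Pos \<Longrightarrow> \<alpha> + \<beta> \<in> Pos \<Longrightarrow> rk (\<alpha> + \<beta>) \<le> m \<Longrightarrow> rk \<alpha> + rk \<beta> \<le> rk (\<alpha> + \<beta>)"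
  shows "rk \<alpha> + rk \<beta> \<le> rk \<gamma>"
  using assms(1-4)
proof (induction arbitrary: \<beta> rule: pos_induct)
  case (less \<gamma>)
  note a = less.prems(1) and b = less.prems(2) and g = less.prems(3)
  consider (J) "rk \<gamma> \<le> m"
    | (split) \<gamma>' \<delta> where "\<gamma>' \<in> Pos" "\<delta> \<in> Pos" "\<gamma> = \<gamma>' + \<delta>" "rk \<gamma> = rk \<gamma>' + rk \<delta>"
    using rk_split[OF less.hyps] by blast
  then show ?case
  proof cases
    case J
    then show ?thesis using low b g less.hyps by blast
  next
    case split
    have step: "rk \<alpha> + rk \<beta> \<le> rk \<gamma>"
      if d: "\<delta> \<in> Pos" "\<gamma>' \<in> Pos" "\<gamma> = \<gamma>' + \<delta>" "rk \<gamma> = rk \<gamma>' + rk \<delta>" and e: "\<alpha> - \<delta> \<in> \<Phi>" for \<gamma>' \<delta>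
    proof -
      have h: "height \<delta> < height \<gamma>" using d height_add height_pos by auto
      from e show ?thesis
      proof (cases rule: pos_or_neg_cases)
        case 1
        have eq: "\<alpha> = \<delta> + (\<alpha> - \<delta>)" "\<gamma>' = \<beta> + (\<alpha> - \<delta>)" using d g by (auto simp: algebra_simps)
        then have "rk \<alpha> < rk \<delta> + rk (\<alpha> - \<delta>)"
          using rk_add_le[OF d(1) 1] indec[OF d(1) 1] by simp
        moreover have "rk \<beta> + rk (\<alpha> - \<delta>) \<le> rk \<gamma>' + 1" using rk_add_ge[OF d(2) b 1 eq(2)] .
        ultimately show ?thesis using d by linarith
      next
        case (2 \<eta>)
        have eq: "\<delta> = \<alpha> + \<eta>" "\<beta> = \<gamma>' + \<eta>" using 2 d g by (auto simp: algebra_simps)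
        then have "rk \<beta> \<le> rk \<gamma>' + rk \<eta>" using rk_add_le[OF d(2) 2(1)] by simp
        moreover have "rk \<alpha> + rk \<eta> \<le> rk \<delta>" using less.IH[OF d(1) h a 2(1) eq(1)] .
        ultimately show ?thesis using d by linarith
      qed
    qed
    have "\<alpha> = \<gamma>' \<or> \<alpha> = \<delta> \<or> \<alpha> - \<gamma>' \<in> \<Phi> \<or> \<alpha> - \<delta> \<in> \<Phi>"
      using two_decompositions[of \<alpha> \<beta> \<gamma>' \<delta>] a b split g less.hyps pos_root by metis
    then consider "\<alpha> = \<gamma>'" | "\<alpha> = \<delta>" | "\<alpha> - \<gamma>' \<in> \<Phi>" | "\<alpha> - \<delta> \<in> \<Phi>" by blast
    then show ?thesis
    proof cases
      case 1
      then have "\<beta> = \<delta>" using g split by simp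
      then show ?thesis using 1 split by simp
    next
      case 2
      then have "\<beta> = \<gamma>'" using g split by simp
      then show ?thesis using 2 split by simp
    next
      case 3
      then show ?thesis using step[of \<gamma>' \<delta>] split by (simp add: add.commute)
    next
      case 4
      then show ?thesis using step[of \<delta> \<gamma>'] split by simp
    qed
  qed
qed

section \<open>The rank as a Shi function, and its tight decompositions\<close>

definition rk_ext :: "'a \<Rightarrow> int" where
  "rk_ext \<alpha> = (if \<alpha> \<in> Pos then int (rk \<alpha>) else 1 - int (rk (- \<alpha>)))"

lemma rk_ext_pos: "\<alpha> \<in> Pos \<Longrightarrow> rk_ext \<alpha> = int (rk \<alpha>)"
  and rk_ext_neg: "\<alpha> \<in> Pos \<Longrightarrow> rk_ext (- \<alpha>) = 1 - int (rk \<alpha>)"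
  using not_neg by (auto simp: rk_ext_def)

text \<open>For two positive roots this is \<open>rk_add_le\<close>, for two negative ones
  \<open>rk_add_ge\<close>; for roots of opposite sign the sign of the sum decides which of the two
  applies.\<close>

lemma shi_rk_ext: "shi rk_ext"
  unfolding shi_def
proof (intro conjI ballI impI)
  fix \<alpha> assume a: "\<alpha> \<in> \<Phi>"
  then show "rk_ext (- \<alpha>) = 1 - rk_ext \<alpha>"
    by (cases rule: pos_or_neg_cases) (auto simp: rk_ext_pos rk_ext_neg)
  fix \<beta> assume b: "\<beta> \<in> \<Phi>" and ab: "\<alpha> + \<beta> \<in> \<Phi>"
  have mixed: "rk_ext (\<mu> - \<nu>) \<le> rk_ext \<mu> + rk_ext (- \<nu>)"
    if mu: "\<mu> \<in> Pos" and nu: "\<nu> \<in> Pos" and d: "\<mu> - \<nu> \<in> \<Phi>" for \<mu> \<nu>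
    using d
  proof (cases rule: pos_or_neg_cases)
    case 1
    then have "rk (\<mu> - \<nu>) + rk \<nu> \<le> rk \<mu> + 1" using rk_add_ge[OF mu 1 nu] by simp
    then show ?thesis using 1 mu nu by (simp add: rk_ext_pos rk_ext_neg)
  next
    case (2 \<eta>)
    then have "\<nu> = \<mu> + \<eta>" by (metis minus_diff_eq minus_minus add.commute diff_add_cancel)
    then have "rk \<nu> \<le> rk \<mu> + rk \<eta>" using rk_add_le[OF mu 2(1)] by simp
    then show ?thesis using 2 mu nu by (simp add: rk_ext_pos rk_ext_neg)
  qed
  from a show "rk_ext (\<alpha> + \<beta>) \<le> rk_ext \<alpha> + rk_ext \<beta>"
  proof (cases rule: pos_or_neg_cases)
    case 1
    note a1 = 1
    from b show ?thesis
    proof (cases rule: pos_or_neg_cases)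
      case 1
      then show ?thesis using a1 pos_add[OF a1 1 ab] rk_add_le[OF a1 1] by (simp add: rk_ext_pos)
    next
      case (2 \<eta>)
      then show ?thesis using mixed[OF a1 2(1)] ab by simp
    qed
  next
    case a2: (2 \<mu>)
    from b show ?thesis
    proof (cases rule: pos_or_neg_cases)
      case 1
      have "\<beta> - \<mu> \<in> \<Phi>" using ab a2 by (simp add: add.commute)
      then show ?thesis using mixed[OF 1 a2(1)] a2 by (simp add: add.commute)
    next
      case b2: (2 \<nu>)
      have eq: "\<alpha> + \<beta> = - (\<mu> + \<nu>)" using a2 b2 by simp
      then have "\<mu> + \<nu> \<in> \<Phi>" using ab by (simp only: uminus_root_iff)
      then have p: "\<mu> + \<nu> \<in> Pos" using pos_add[OF a2(1) b2(1)] by simp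
      have "rk \<mu> + rk \<nu> \<le> rk (\<mu> + \<nu>) + 1" using rk_add_ge[OF p a2(1) b2(1)] by simp
      moreover have "rk_ext (\<alpha> + \<beta>) = 1 - int (rk (\<mu> + \<nu>))" unfolding eq by (rule rk_ext_neg[OF p])
      moreover have "rk_ext \<alpha> = 1 - int (rk \<mu>)" "rk_ext \<beta> = 1 - int (rk \<nu>)"
        using a2 b2 by (auto simp: rk_ext_neg)
      ultimately show ?thesis by linarith
    qed
  qed
qed

text \<open>The second alternative comes from
  \<open>\<alpha> = (\<alpha> + \<beta>) + (- \<beta>)\<close>, where \<open>- \<beta>\<close> has
  value \<open>1 - rk \<beta>\<close>: it is equality in \<open>rk_add_ge\<close>. Two negative
  roots cannot add up to a positive one.\<close>

lemma tight_rk_ext_iff: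
  assumes a: "\<alpha> \<in> Pos"
  shows "tight rk_ext \<alpha> \<longleftrightarrow>
    (\<exists>\<beta>\<in>Pos. \<exists>\<gamma>\<in>Pos. \<alpha> = \<beta> + \<gamma> \<and> rk \<alpha> = rk \<beta> + rk \<gamma>) \<or>
    (\<exists>\<beta>\<in>Pos. \<alpha> + \<beta> \<in> Pos \<and> rk (\<alpha> + \<beta>) + 1 = rk \<alpha> + rk \<beta>)" (is "_ \<longleftrightarrow> ?A \<or> ?B")
proof
  assume "tight rk_ext \<alpha>"
  then obtain b c where bc: "b \<in> \<Phi>" "c \<in> \<Phi>" "\<alpha> = b + c" "rk_ext \<alpha> = rk_ext b + rk_ext c"
    unfolding tight_def by blast
  have mixed: ?B if "\<mu> \<in> Pos" "\<nu> \<in> Pos" "\<alpha> = \<mu> - \<nu>" "rk_ext \<alpha> = rk_ext \<mu> + rk_ext (- \<nu>)" for \<mu> \<nu>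
  proof (rule bexI[OF _ that(2)])
    have "\<alpha> + \<nu> = \<mu>" using that by simp
    then show "\<alpha> + \<nu> \<in> Pos \<and> rk (\<alpha> + \<nu>) + 1 = rk \<alpha> + rk \<nu>"
      using that a by (simp add: rk_ext_pos rk_ext_neg)
  qed
  from bc(1) show "?A \<or> ?B"
  proof (cases rule: pos_or_neg_cases)
    case 1
    note b1 = 1
    from bc(2) show ?thesis
    proof (cases rule: pos_or_neg_cases)
      case 1
      then have "rk \<alpha> = rk b + rk c" using bc b1 a by (simp add: rk_ext_pos)
      then show ?thesis using bc b1 1 by blast
    next
      case (2 \<nu>)
      then show ?thesis using mixed[OF b1 2(1)] bc by simp
    qed
  next
    case b2: (2 \<mu>)
    from bc(2) show ?thesis
    proof (cases rule: pos_or_neg_cases)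
      case 1
      then show ?thesis using mixed[OF 1 b2(1)] bc b2 by simp
    next
      case (2 \<nu>)
      have "- \<alpha> = \<mu> + \<nu>" using bc b2 2 by simp
      then have "nonneg_comb \<Delta> (- \<alpha>)" using b2 2 pos_comb nonneg_comb_add by metis
      then show ?thesis using a not_neg[OF a] pos_root[OF a] by (simp add: pos_roots_def)
    qed
  qed
next
  assume "?A \<or> ?B"
  then show "tight rk_ext \<alpha>"
  proof
    assume ?A
    then show ?thesis unfolding tight_def using a by (metis rk_ext_pos pos_root of_nat_add)
  next
    assume ?B
    then obtain \<beta> where b: "\<beta> \<in> Pos" "\<alpha> + \<beta> \<in> Pos" "rk (\<alpha> + \<beta>) + 1 = rk \<alpha> + rk \<beta>" by blast
    show ?thesis unfolding tight_def
    proof (rule bexI[of _ "\<alpha> + \<beta>"], rule bexI[of _ "- \<beta>"])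
      show "\<alpha> = \<alpha> + \<beta> + - \<beta> \<and> rk_ext \<alpha> = rk_ext (\<alpha> + \<beta>) + rk_ext (- \<beta>)"
        using a b by (simp add: rk_ext_pos rk_ext_neg)
    qed (use b pos_root in auto)
  qed
qed

text \<open>Membership in an ideal is read as a bound on the rank by \<open>in_J_iff\<close>; for a
  decomposition with labels adding up to \<open>r = rk \<alpha>\<close>, subadditivity forces the
  labels to be the ranks.\<close>

lemma indecomposable_iff:
  assumes r: "1 \<le> r" "r \<le> m" and a: "\<alpha> \<in> Pos"
  shows "indecomposable \<Phi> \<Delta> J m r \<alpha> \<longleftrightarrow> rk \<alpha> = r
    \<and> \<not> (\<exists>\<beta>\<in>Pos. \<exists>\<gamma>\<in>Pos. \<alpha> = \<beta> + \<gamma> \<and> rk \<alpha> = rk \<beta> + rk \<gamma>)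
    \<and> (\<forall>\<beta>\<in>Pos. \<alpha> + \<beta> \<in> Pos \<longrightarrow> rk (\<alpha> + \<beta>) \<le> m \<longrightarrow> rk \<alpha> + rk \<beta> \<le> rk (\<alpha> + \<beta>))"
proof (cases "rk \<alpha> = r")
  case True
  note rk = True
  have aJ: "\<alpha> \<in> J r" using in_J_iff a r rk by simp
  have sum: "(\<exists>\<beta> \<gamma> i j. 1 \<le> i \<and> 1 \<le> j \<and> i + j = r \<and> \<beta> \<in> J i \<and> \<gamma> \<in> J j \<and> \<alpha> = \<beta> + \<gamma>)
     \<longleftrightarrow> (\<exists>\<beta>\<in>Pos. \<exists>\<gamma>\<in>Pos. \<alpha> = \<beta> + \<gamma> \<and> rk \<alpha> = rk \<beta> + rk \<gamma>)" (is "?L \<longleftrightarrow> ?R")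
  proof
    assume ?L
    then obtain \<beta> \<gamma> i j where L: "i + j = r" "\<beta> \<in> J i" "\<gamma> \<in> J j" "\<alpha> = \<beta> + \<gamma>" by blast
    then have P: "\<beta> \<in> Pos" "\<gamma> \<in> Pos" and "rk \<beta> \<le> i" "rk \<gamma> \<le> j"
      using J_pos[of i] J_pos[of j] rk_le_if_in_J r by auto
    then have "rk \<alpha> = rk \<beta> + rk \<gamma>" using rk_add_le[OF P] L rk by simp
    then show ?R using P L by blast
  next
    assume ?R
    then obtain \<beta> \<gamma> where R: "\<beta> \<in> Pos" "\<gamma> \<in> Pos" "\<alpha> = \<beta> + \<gamma>" "rk \<alpha> = rk \<beta> + rk \<gamma>" by blast
    then have "\<beta> \<in> J (rk \<beta>)" "\<gamma> \<in> J (rk \<gamma>)" using in_J_rk r rk by auto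
    then show ?L using R rk rk_pos by metis
  qed
  \<comment> \<open>The subtraction is truncated, but ranks are at least 1, so membership of
    \<open>\<beta>\<close> already forces \<open>rk (\<alpha> + \<beta>) > r\<close>.\<close>
  have low: "(\<beta> \<in> J (rk (\<alpha> + \<beta>) - r)) \<longleftrightarrow> rk \<alpha> + rk \<beta> \<le> rk (\<alpha> + \<beta>)"
    if b: "\<beta> \<in> Pos" "\<alpha> + \<beta> \<in> Pos" "rk (\<alpha> + \<beta>) \<le> m" for \<beta>
  proof -
    have "\<beta> \<in> J (rk (\<alpha> + \<beta>) - r) \<longleftrightarrow> rk \<beta> \<le> rk (\<alpha> + \<beta>) - r" using in_J_iff b by simp
    then show ?thesis using rk_pos[OF b(1)] rk by auto
  qed
  show ?thesis
    unfolding indecomposable_def sum using low r a aJ rk by blast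
qed (auto simp: indecomposable_def)

text \<open>The first kind of tight decomposition is excluded by indecomposability itself, the
  second by \<open>rk_add_exact\<close>, also where \<open>\<alpha> + \<beta>\<close> has rank above
  \<open>m\<close>.\<close>

lemma indecomposable_not_tight:
  assumes r: "1 \<le> r" "r \<le> m" and a: "\<alpha> \<in> Pos" and ind: "indecomposable \<Phi> \<Delta> J m r \<alpha>"
  shows "\<not> tight rk_ext \<alpha>"
proof -
  have noA: "rk \<alpha> \<noteq> rk \<mu> + rk \<nu>" if "\<mu> \<in> Pos" "\<nu> \<in> Pos" "\<alpha> = \<mu> + \<nu>" for \<mu> \<nu>
    using ind that unfolding indecomposable_iff[OF r a] by blast
  have "rk \<alpha> + rk \<beta> \<le> rk (\<alpha> + \<beta>)" if b: "\<beta> \<in> Pos" "\<alpha> + \<beta> \<in> Pos" for \<beta>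
    by (rule rk_add_exact[OF b(2) a b(1) refl noA])
      (use ind in \<open>auto simp: indecomposable_iff[OF r a]\<close>)
  then show ?thesis unfolding tight_rk_ext_iff[OF a] using noA by fastforce
qed

end

section \<open>Walls\<close>

text \<open>The face cut out by the hyperplane contains all its points near \<open>x\<close>, as
  limits of points of \<open>S\<close> below, so it has codimension one; \<open>S\<close> contains a
  half-ball, so its closure has full dimension.\<close>

lemma is_wall_if_point:
  assumes a: "a \<noteq> 0" and S: "convex S" and below: "\<And>y. y \<in> S \<Longrightarrow> a \<bullet> y < k"
    and x: "a \<bullet> x = k" and e: "0 < e" and near: "\<And>y. y \<in> ball x e \<Longrightarrow> a \<bullet> y < k \<Longrightarrow> y \<in> S"
  shows "is_wall a k S"
proof -
  define F where "F = closure S \<inter> {y. a \<bullet> y = k}"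
  have le: "a \<bullet> y \<le> k" if "y \<in> closure S" for y
    using closure_minimal[of S "{y. a \<bullet> y \<le> k}"] that below by (force simp: closed_halfspace_le)
  have cl: "y \<in> closure S" if y: "y \<in> ball x e" "a \<bullet> y = k" for y
  proof (rule Lim_in_closed_set)
    have lim: "((\<lambda>t. y - t *\<^sub>R a) \<longlongrightarrow> y - 0 *\<^sub>R a) (at_right 0)" by (intro tendsto_intros)
    then show "((\<lambda>t. y - t *\<^sub>R a) \<longlongrightarrow> y) (at_right 0)" by simp
    have "\<forall>\<^sub>F t in at_right 0. y - t *\<^sub>R a \<in> ball x e"
      using topological_tendstoD[OF lim open_ball[of x e]] y by simp
    then show "\<forall>\<^sub>F t in at_right 0. y - t *\<^sub>R a \<in> closure S"
      using eventually_at_right_less[of 0]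
    proof eventually_elim
      case (elim t)
      have "a \<bullet> (y - t *\<^sub>R a) < k" using elim a y by (simp add: inner_diff_right)
      then show ?case using near elim closure_subset by blast
    qed
  qed auto
  let ?H = "{y. a \<bullet> y = k}"
  have "aff_dim (?H \<inter> ball x e) = aff_dim ?H"
    using x e by (intro aff_dim_openin openin_open_Int affine_hyperplane) auto
  moreover have "?H \<inter> ball x e \<subseteq> F" using cl by (auto simp: F_def)
  moreover have "F \<subseteq> ?H" by (auto simp: F_def)
  ultimately have "aff_dim F = aff_dim ?H" by (metis aff_dim_subset order_antisym)
  then have dimF: "aff_dim F = int DIM('a) - 1" using a by simp
  let ?U = "ball x e \<inter> {y. a \<bullet> y < k}"
  have "\<exists>y. y \<in> ?U"
  proof -
    have "((\<lambda>t. x - t *\<^sub>R a) \<longlongrightarrow> x - 0 *\<^sub>R a) (at_right 0)" by (intro tendsto_intros)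
    then have "\<forall>\<^sub>F t in at_right 0. x - t *\<^sub>R a \<in> ball x e"
      by (rule topological_tendstoD) (use e in auto)
    then have "\<forall>\<^sub>F t in at_right 0. x - t *\<^sub>R a \<in> ?U"
      using eventually_at_right_less[of 0]
      by eventually_elim (use a x in \<open>auto simp: inner_diff_right\<close>)
    then show ?thesis using eventually_happens[of _ "at_right (0::real)"] trivial_limit_at_right_real by blast
  qed
  then have "aff_dim ?U = int DIM('a)"
    by (intro aff_dim_open) (auto intro: open_halfspace_lt)
  moreover have "?U \<subseteq> closure S" using near closure_subset by blast
  ultimately have dimS: "aff_dim (closure S) = int DIM('a)"
    by (metis aff_dim_subset aff_dim_le_DIM order_antisym)
  have "F face_of closure S"
    unfolding F_def using S le by (intro face_of_Int_supporting_hyperplane_le) auto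
  moreover have "F \<noteq> {}" using cl[of x] x e by (auto simp: F_def)
  ultimately have "F facet_of closure S" using dimF dimS by (simp add: facet_of_def)
  moreover have "F \<subseteq> hyp a k" by (auto simp: F_def hyp_def)
  ultimately show ?thesis unfolding is_wall_def using a le by blast
qed

text \<open>The affine hull of the facet is the whole hyperplane of \<open>a\<close>, so
  \<open>b\<close> is constant there. Moving along the component of \<open>b\<close> orthogonal to
  \<open>a\<close> stays in that hyperplane, so this component vanishes.\<close>

lemma facet_in_two_hyperplanes:
  assumes F: "F facet_of closure S" and S: "open S" "S \<noteq> {}" and a: "a \<noteq> 0"
    and Fa: "\<And>x. x \<in> F \<Longrightarrow> a \<bullet> x = k" and Fb: "\<And>x. x \<in> F \<Longrightarrow> b \<bullet> x = c"
  shows "\<exists>t. b = t *\<^sub>R a"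
proof -
  let ?H = "{y. a \<bullet> y = k}"
  have "aff_dim F = int DIM('a) - 1"
    using F S by (simp add: facet_of_def aff_dim_open)
  then have "aff_dim (affine hull F) = aff_dim ?H" using a by simp
  moreover have "affine hull F \<subseteq> ?H"
    using Fa by (intro hull_minimal affine_hyperplane) auto
  moreover have ne: "F \<noteq> {}" using F by (auto simp: facet_of_def)
  ultimately have "affine hull F = ?H"
    by (intro affine_dim_equal affine_affine_hull affine_hyperplane) auto
  moreover have "affine hull F \<subseteq> {y. b \<bullet> y = c}"
    using Fb by (intro hull_minimal affine_hyperplane) auto
  ultimately have sub: "?H \<subseteq> {y. b \<bullet> y = c}" by simp
  obtain x where x: "x \<in> F" using ne by blast
  define t where "t = (a \<bullet> b) / (a \<bullet> a)"
  define p where "p = b - t *\<^sub>R a"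
  have ap: "a \<bullet> p = 0" using a by (simp add: p_def t_def inner_diff_right)
  then have "x + p \<in> ?H" using Fa[OF x] by (simp add: inner_add_right)
  then have "b \<bullet> (x + p) = c" using sub by blast
  then have "b \<bullet> p = 0" using Fb[OF x] by (simp add: inner_add_right)
  then have "p \<bullet> p = 0" using ap by (simp add: p_def inner_diff_left inner_commute)
  then show ?thesis by (auto simp: p_def)
qed

lemma closure_inner_le:
  assumes "\<And>x. x \<in> S \<Longrightarrow> a \<bullet> x \<le> k" "y \<in> closure S"
  shows "a \<bullet> y \<le> k"
  using closure_minimal[of S "{y. a \<bullet> y \<le> k}"] assms by (auto simp: closed_halfspace_le)

text \<open>On the facet the two bounds add up to an equality, so each is attained and the facet
  lies in the hyperplane of \<open>b\<close> too.\<close>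

lemma is_wall_sum_parallel:
  assumes w: "is_wall a k S" and S: "open S" "S \<noteq> {}" and a: "a = b + c" and k: "k = p + q"
    and b: "\<And>x. x \<in> S \<Longrightarrow> b \<bullet> x \<le> p" and c: "\<And>x. x \<in> S \<Longrightarrow> c \<bullet> x \<le> q"
  shows "\<exists>t. b = t *\<^sub>R a"
proof -
  obtain F where F: "F facet_of closure S" "F \<subseteq> hyp a k" and a0: "a \<noteq> 0"
    using w unfolding is_wall_def by blast
  have cl: "F \<subseteq> closure S" using F(1) facet_of_imp_subset by blast
  show ?thesis
  proof (rule facet_in_two_hyperplanes[OF F(1) S a0])
    fix x assume x: "x \<in> F"
    then show *: "a \<bullet> x = k" using F(2) by (auto simp: hyp_def)
    have "b \<bullet> x \<le> p" "c \<bullet> x \<le> q" using closure_inner_le b c cl x by blast+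
    then show "b \<bullet> x = p" using * a k by (simp add: inner_add_left)
  qed
qed

section \<open>Affine reflections and the affine Weyl group acting on alcoves\<close>

lemma inner_refl_aff:
  "a \<bullet> refl_aff d j x = refl_aff d 0 a \<bullet> x + 2 * (d \<bullet> a) / (d \<bullet> d) * j"
  by (cases "d \<bullet> d = 0") (auto simp: refl_aff_def inner_diff_left inner_diff_right inner_commute field_simps)

lemma refl_aff_involution: "refl_aff d j (refl_aff d j x) = x"
proof (cases "d = 0")
  case False
  then have e: "d \<bullet> refl_aff d j x - j = - (d \<bullet> x - j)"
    by (simp add: refl_aff_def inner_diff_right)
  have "refl_aff d j (refl_aff d j x) = refl_aff d j x - (2 * - (d \<bullet> x - j) / (d \<bullet> d)) *\<^sub>R d"
    unfolding refl_aff_def[of d j "refl_aff d j x"] e ..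
  also have "\<dots> = refl_aff d j x + (2 * (d \<bullet> x - j) / (d \<bullet> d)) *\<^sub>R d"
    by (simp only: mult_minus_right minus_divide_left[symmetric] scaleR_minus_left diff_minus_eq_add)
  also have "\<dots> = x" by (simp only: refl_aff_def diff_add_cancel)
  finally show ?thesis .
qed (simp add: refl_aff_def)

context root_sys
begin

text \<open>The only candidates for \<open>b\<close> are \<open>a\<close> and \<open>- a\<close>,
  with differences 0 and twice \<open>a\<close>.\<close>

lemma root_multiple: "a \<in> \<Phi> \<Longrightarrow> b \<in> \<Phi> \<Longrightarrow> b = t *\<^sub>R a \<Longrightarrow> a - b \<notin> \<Phi>"
proof
  assume *: "a \<in> \<Phi>" "b \<in> \<Phi>" "b = t *\<^sub>R a" "a - b \<in> \<Phi>"
  then have "t = 1 \<or> t = -1" using reduced by blast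
  then show False
  proof
    assume "t = -1"
    then have "a - b = 2 *\<^sub>R a" using * by (simp add: scaleR_2)
    then show False using reduced[of a 2] * by auto
  qed (use * zero_notin in auto)
qed

lemma refl_aff_inner_root:
  assumes "\<delta> \<in> \<Phi>" "\<alpha> \<in> \<Phi>"
  shows "\<exists>\<beta>\<in>\<Phi>. \<exists>k::int. \<forall>x. \<alpha> \<bullet> refl_aff \<delta> (of_int j) x = \<beta> \<bullet> x + of_int k"
proof -
  obtain n where n: "2 * (\<delta> \<bullet> \<alpha>) / (\<delta> \<bullet> \<delta>) = of_int n"
    using cartan_int[OF assms] by (auto elim: Ints_cases)
  show ?thesis
    by (intro bexI[OF _ refl_root[OF assms]] exI[of _ "n * j"]) (simp add: inner_refl_aff n)
qed

lemma affine_weyl_bij: "w \<in> affine_weyl \<Phi> \<Longrightarrow> bij w"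
proof (induction rule: affine_weyl.induct)
  case (aw_refl \<alpha> w k)
  have "bij (refl_aff \<alpha> (of_int k))" by (rule involuntory_imp_bij) (rule refl_aff_involution)
  then show ?case using aw_refl.IH bij_comp by blast
qed (rule bij_id)

lemma affine_weyl_inner:
  assumes "w \<in> affine_weyl \<Phi>" "\<alpha> \<in> \<Phi>"
  shows "\<exists>\<beta>\<in>\<Phi>. \<exists>k::int. \<forall>x. \<alpha> \<bullet> w x = \<beta> \<bullet> x + of_int k"
  using assms
proof (induction arbitrary: \<alpha> rule: affine_weyl.induct)
  case aw_id
  then show ?case by (intro bexI[of _ \<alpha>] exI[of _ 0]) auto
next
  case (aw_refl \<delta> w j)
  obtain \<beta> k where b: "\<beta> \<in> \<Phi>" "\<And>x. \<alpha> \<bullet> refl_aff \<delta> (of_int j) x = \<beta> \<bullet> x + of_int k"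
    using refl_aff_inner_root[OF aw_refl.hyps(1) aw_refl.prems, of j] by blast
  obtain \<gamma> l where "\<gamma> \<in> \<Phi>" "\<And>x. \<beta> \<bullet> w x = \<gamma> \<bullet> x + of_int l" using aw_refl.IH[OF b(1)] by blast
  then show ?case using b(2) by (intro bexI[of _ \<gamma>] exI[of _ "l + k"]) auto
qed

text \<open>This is \<open>affine_weyl_inner\<close> for the inverse of \<open>w\<close>; the
  induction step undoes the new reflection by applying it once more.\<close>

lemma affine_weyl_inner_inv:
  assumes "w \<in> affine_weyl \<Phi>" "\<alpha> \<in> \<Phi>"
  shows "\<exists>\<beta>\<in>\<Phi>. \<exists>k::int. \<forall>x. \<alpha> \<bullet> x = \<beta> \<bullet> w x + of_int k"
  using assms
proof (induction arbitrary: \<alpha> rule: affine_weyl.induct)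
  case aw_id
  then show ?case by (intro bexI[of _ \<alpha>] exI[of _ 0]) auto
next
  case (aw_refl \<delta> w j)
  obtain \<beta> k where b: "\<beta> \<in> \<Phi>" "\<And>x. \<alpha> \<bullet> x = \<beta> \<bullet> w x + of_int k"
    using aw_refl.IH[OF aw_refl.prems] by blast
  obtain \<gamma> l where g: "\<gamma> \<in> \<Phi>" "\<And>x. \<beta> \<bullet> refl_aff \<delta> (of_int j) x = \<gamma> \<bullet> x + of_int l"
    using refl_aff_inner_root[OF aw_refl.hyps(1) b(1), of j] by blast
  have "\<alpha> \<bullet> x = \<gamma> \<bullet> refl_aff \<delta> (of_int j) (w x) + of_int (l + k)" for x
    using b(2)[of x] g(2)[of "refl_aff \<delta> (of_int j) (w x)"] by (simp add: refl_aff_involution)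
  then show ?case using g(1) by (intro bexI[of _ \<gamma>] exI[of _ "l + k"]) (simp_all only: comp_def simp_thms)
qed

lemma open_alcove: "open (alcove f)"
proof -
  have "alcove f = (\<Inter>a\<in>\<Phi>. {x. a \<bullet> x < of_int (f a)})" by (auto simp: alcove_def)
  then show ?thesis using fin by (auto intro: open_halfspace_lt)
qed

lemma convex_alcove: "convex (alcove f)"
proof -
  have "alcove f = (\<Inter>a\<in>\<Phi>. {x. a \<bullet> x < of_int (f a)})" by (auto simp: alcove_def)
  then show ?thesis by (auto intro!: convex_INT convex_halfspace_lt)
qed

text \<open>Roots pull back to roots up to integer constants, so the bounds of both alcoves can be
  compared as integers: a common point \<open>x0\<close> shows
  \<open>g \<beta> + k \<le> f \<alpha>\<close>, and the bounds on \<open>y\<close> carry over to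
  its preimage.\<close>

lemma affine_weyl_alcove:
  assumes w: "w \<in> affine_weyl \<Phi>" and f: "shi f" and g: "shi g" and sub: "w ` alcove f \<subseteq> alcove g"
  shows "w ` alcove f = alcove g"
proof
  show "alcove g \<subseteq> w ` alcove f"
  proof
    fix y assume y: "y \<in> alcove g"
    obtain x where x: "y = w x" using affine_weyl_bij[OF w] by (metis bij_pointE)
    obtain x0 where x0: "x0 \<in> alcove f" using alcove_nonempty[OF f] by blast
    have "\<alpha> \<bullet> x < of_int (f \<alpha>)" if a: "\<alpha> \<in> \<Phi>" for \<alpha>
    proof -
      obtain \<beta> k where b: "\<beta> \<in> \<Phi>" "\<And>x. \<alpha> \<bullet> x = \<beta> \<bullet> w x + of_int k"
        using affine_weyl_inner_inv[OF w a] by blast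
      have "w x0 \<in> alcove g" using sub x0 by blast
      then have "of_int (g \<beta>) - 1 < \<beta> \<bullet> w x0" "\<beta> \<bullet> y < of_int (g \<beta>)"
        using alcove_lower[OF g _ b(1)] y b(1) by (auto simp: alcove_def)
      moreover have "\<alpha> \<bullet> x0 < of_int (f \<alpha>)" using x0 a by (auto simp: alcove_def)
      ultimately have "of_int (g \<beta> + k) - 1 < (of_int (f \<alpha>) :: real)" and *: "\<alpha> \<bullet> x < of_int (g \<beta> + k)"
        using b(2)[of x0] b(2)[of x] x by auto
      then have "g \<beta> + k \<le> f \<alpha>" by linarith
      then have "real_of_int (g \<beta> + k) \<le> of_int (f \<alpha>)" by (simp only: of_int_le_iff)
      then show ?thesis using * by linarith
    qed
    then show "y \<in> w ` alcove f" using x by (auto simp: alcove_def)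
  qed
qed (rule sub)

end

section \<open>The fundamental alcove\<close>

context pos_root_sys
begin

definition fund_shi :: "'a \<Rightarrow> int" where
  "fund_shi \<alpha> = (if \<alpha> \<in> Pos then 1 else 0)"

lemma shi_fund: "shi fund_shi"
  unfolding shi_def
proof (intro conjI ballI impI)
  fix a assume a: "a \<in> \<Phi>"
  then show "fund_shi (- a) = 1 - fund_shi a"
    using pos_or_neg[OF a] not_neg[of a] by (auto simp: fund_shi_def)
  fix b assume b: "b \<in> \<Phi>" and ab: "a + b \<in> \<Phi>"
  have "a + b \<notin> Pos" if "- a \<in> Pos" "- b \<in> Pos"
  proof -
    have "- a + - b \<in> \<Phi>" using ab uminus_root[OF ab] by simp
    then have "- (a + b) \<in> Pos" using pos_add[OF that] by simp
    then show ?thesis using not_neg by blast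
  qed
  then show "fund_shi (a + b) \<le> fund_shi a + fund_shi b"
    using pos_or_neg[OF a] pos_or_neg[OF b] by (auto simp: fund_shi_def)
qed

text \<open>The bounds at the simple roots and at \<open>\<theta>\<close> imply all others: a
  positive root is a nonempty sum of simple roots, and \<open>\<theta>\<close> minus it is a
  nonnegative combination.\<close>

lemma fund_alcove_eq:
  assumes th: "highest_root \<Phi> \<Delta> \<theta>"
  shows "fund_alcove \<Delta> \<theta> = alcove fund_shi"
proof (intro set_eqI iffI)
  fix x assume x: "x \<in> fund_alcove \<Delta> \<theta>"
  have nonneg: "0 \<le> v \<bullet> x" if "nonneg_comb \<Delta> v" for v
  proof -
    obtain c where "\<forall>\<sigma>\<in>\<Delta>. 0 \<le> c \<sigma>" "v = (\<Sum>\<sigma>\<in>\<Delta>. c \<sigma> *\<^sub>R \<sigma>)"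
      using \<open>nonneg_comb \<Delta> v\<close> unfolding nonneg_comb_def by blast
    moreover have "0 \<le> \<sigma> \<bullet> x" if "\<sigma> \<in> \<Delta>" for \<sigma> using x that by (simp add: fund_alcove_def less_imp_le)
    ultimately show ?thesis by (simp add: inner_sum_left sum_nonneg)
  qed
  have pos: "0 < a \<bullet> x" if a: "a \<in> Pos" for a
  proof -
    obtain vs where vs: "vs \<noteq> []" "set vs \<subseteq> \<Delta>" "sum_list vs = a" using pos_is_sum_of_simple[OF a] by blast
    then obtain v us where v: "vs = v # us" by (cases vs) auto
    have "nonneg_comb \<Delta> (sum_list us)"
      using vs v simple_pos pos_comb by (intro nonneg_comb_sum_list) auto
    then have "0 \<le> sum_list us \<bullet> x" by (rule nonneg)
    moreover have "0 < v \<bullet> x" using x vs v by (auto simp: fund_alcove_def)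
    ultimately show ?thesis using vs v by (auto simp: inner_add_left)
  qed
  show "x \<in> alcove fund_shi" unfolding alcove_def
  proof (intro CollectI ballI)
    fix a assume a: "a \<in> \<Phi>"
    show "a \<bullet> x < of_int (fund_shi a)"
    proof (cases "a \<in> Pos")
      case True
      then have "0 \<le> (\<theta> - a) \<bullet> x" using th nonneg by (auto simp: highest_root_def root_le_def)
      moreover have "\<theta> \<bullet> x < 1" using x by (simp add: fund_alcove_def)
      ultimately show ?thesis using True by (simp add: fund_shi_def inner_diff_left)
    next
      case False
      then have "0 < (- a) \<bullet> x" using pos_or_neg[OF a] pos by blast
      then show ?thesis using False by (simp add: fund_shi_def)
    qed
  qed
next
  fix x assume x: "x \<in> alcove fund_shi"
  have th': "\<theta> \<in> Pos" using th by (simp add: highest_root_def)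
  have "0 < \<sigma> \<bullet> x" if "\<sigma> \<in> \<Delta>" for \<sigma>
    using alcove_lower[OF shi_fund x pos_root[OF simple_pos[OF that]]] simple_pos[OF that]
    by (simp add: fund_shi_def)
  moreover have "\<theta> \<bullet> x < of_int (fund_shi \<theta>)" using x pos_root[OF th'] by (simp add: alcove_def)
  ultimately show "x \<in> fund_alcove \<Delta> \<theta>" using th' by (simp add: fund_alcove_def fund_shi_def)
qed

text \<open>The fundamental alcove is nonempty and lies below the hyperplane, since \<alpha> is less
  than 1 on it.\<close>

lemma not_separates_fund_alcove_iff:
  assumes th: "highest_root \<Phi> \<Delta> \<theta>" and a: "\<alpha> \<in> Pos" and r: "1 \<le> r"
  shows "not_separates \<alpha> (real r) S (fund_alcove \<Delta> \<theta>) \<longleftrightarrow> (\<forall>x\<in>S. \<alpha> \<bullet> x < real r)"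
proof -
  have lt: "\<alpha> \<bullet> x < real r" if "x \<in> fund_alcove \<Delta> \<theta>" for x
  proof -
    have "\<alpha> \<bullet> x < of_int (fund_shi \<alpha>)"
      using that pos_root[OF a] by (simp add: fund_alcove_eq[OF th] alcove_def)
    then show ?thesis using a r by (simp add: fund_shi_def)
  qed
  obtain x where "x \<in> fund_alcove \<Delta> \<theta>" using alcove_nonempty[OF shi_fund] fund_alcove_eq[OF th] by blast
  then show ?thesis using lt unfolding not_separates_def by (meson less_asym)
qed

text \<open>Shows that the description defining \<open>r_w\<close> is met: a strip exists by
  \<open>affine_weyl_inner\<close>, and the point \<open>y\<close> makes it unique.\<close>

lemma r_w_bounds:
  assumes th: "highest_root \<Phi> \<Delta> \<theta>" and w: "w \<in> affine_weyl \<Phi>" and a: "\<alpha> \<in> \<Phi>"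
    and y: "y \<in> w ` fund_alcove \<Delta> \<theta>"
  shows "of_int (r_w \<Delta> \<theta> w \<alpha>) - 1 < \<alpha> \<bullet> y \<and> \<alpha> \<bullet> y < of_int (r_w \<Delta> \<theta> w \<alpha>)"
proof -
  let ?P = "\<lambda>s::int. \<forall>x\<in>w ` fund_alcove \<Delta> \<theta>. of_int s - 1 < \<alpha> \<bullet> x \<and> \<alpha> \<bullet> x < of_int s"
  obtain \<beta> k where b: "\<beta> \<in> \<Phi>" "\<And>x. \<alpha> \<bullet> w x = \<beta> \<bullet> x + of_int k"
    using affine_weyl_inner[OF w a] by blast
  have "?P (fund_shi \<beta> + k)"
    using b alcove_lower[OF shi_fund _ b(1)] by (fastforce simp: fund_alcove_eq[OF th] alcove_def)
  moreover have "s = fund_shi \<beta> + k" if "?P s" for s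
    using bspec[OF that y] bspec[OF \<open>?P (fund_shi \<beta> + k)\<close> y] by linarith
  ultimately have "?P (r_w \<Delta> \<theta> w \<alpha>)" unfolding r_w_def by (rule theI)
  then show ?thesis using y by blast
qed

end

section \<open>Walls of the region and of its alcove\<close>

context ideal_chain
begin

abbreviation R :: "'a set" where "R \<equiv> region_of \<Phi> \<Delta> J m"

lemma region_upper: "x \<in> R \<Longrightarrow> \<alpha> \<in> Pos \<Longrightarrow> rk \<alpha> \<le> m \<Longrightarrow> \<alpha> \<bullet> x < rk \<alpha>"
  using in_J_rk unfolding region_of_def by blast

lemma region_lower:
  assumes x: "x \<in> R" and a: "\<alpha> \<in> Pos" and m: "rk \<alpha> - 1 \<le> m"
  shows "real (rk \<alpha>) - 1 < \<alpha> \<bullet> x"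
proof -
  have "\<alpha> \<in> co_chain \<Phi> \<Delta> J m (rk \<alpha> - 1)"
    using a in_J_iff[OF a m] rk_pos[OF a] m by (auto simp: co_chain_def min_absorb1)
  then have "real (rk \<alpha> - 1) < \<alpha> \<bullet> x" using x m unfolding region_of_def by blast
  then show ?thesis using rk_pos[OF a] by (simp add: of_nat_diff)
qed

lemma alcove_subset_region: "alcove rk_ext \<subseteq> R"
proof
  fix x assume x: "x \<in> alcove rk_ext"
  have b: "real (rk \<alpha>) - 1 < \<alpha> \<bullet> x" "\<alpha> \<bullet> x < rk \<alpha>" if "\<alpha> \<in> Pos" for \<alpha>
    using alcove_lower[OF shi_rk_ext x pos_root[OF that]] x pos_root[OF that] rk_ext_pos[OF that]
    by (auto simp: alcove_def)
  have "real r < \<alpha> \<bullet> x" if "r \<le> m" "\<alpha> \<in> co_chain \<Phi> \<Delta> J m r" for r \<alpha>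
  proof -
    have a: "\<alpha> \<in> Pos" "\<alpha> \<notin> J r" using that by (auto simp: co_chain_def min_absorb1)
    then have "r < rk \<alpha>" using in_J_iff that by auto
    then show ?thesis using b(1)[OF a(1)] by linarith
  qed
  moreover have "0 < \<alpha> \<bullet> x \<and> \<alpha> \<bullet> x < real r" if "r \<le> m" "\<alpha> \<in> J r" for r \<alpha>
  proof -
    have a: "\<alpha> \<in> Pos" and "rk \<alpha> \<le> r" using that J_pos in_J_iff by auto
    then show ?thesis using b[OF a] rk_pos[OF a] by linarith
  qed
  ultimately show "x \<in> R" unfolding region_of_def by blast
qed

lemma region_eq_Int:
  "R = (\<Inter>r\<in>{..m}. (\<Inter>\<alpha>\<in>Pos - J r. {x. real r < \<alpha> \<bullet> x}) \<inter> (\<Inter>\<alpha>\<in>J r. {x. 0 < \<alpha> \<bullet> x} \<inter> {x. \<alpha> \<bullet> x < real r}))"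
  by (auto simp: region_of_def co_chain_def min_absorb1)

lemma open_region: "open R"
proof -
  have "finite (J r)" if "r \<le> m" for r
    using J_pos[OF that] by (intro finite_subset[OF _ fin_pos] subsetI)
  then show ?thesis unfolding region_eq_Int using fin_pos
    by (intro open_INT open_Int ballI open_halfspace_lt open_halfspace_gt finite_Diff) auto
qed

lemma convex_region: "convex R"
  unfolding region_eq_Int
  by (intro convex_INT convex_Int convex_halfspace_lt convex_halfspace_gt)

text \<open>Stated for any open convex set between the alcove and \<open>R\<close>, so that it
  serves for both. Excluding tight decompositions of a wall takes only bounds valid on
  \<open>R\<close>; conversely a half-ball at a point of the alcove's facet lies in the alcove,
  hence in \<open>S\<close>.\<close>

theorem wall_iff_indecomposable:
  assumes S: "open S" "convex S" "alcove rk_ext \<subseteq> S" "S \<subseteq> R"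
    and r: "1 \<le> r" "r \<le> m" and a: "\<alpha> \<in> Pos"
  shows "is_wall \<alpha> (real r) S \<and> (\<forall>x\<in>S. \<alpha> \<bullet> x < real r) \<longleftrightarrow> indecomposable \<Phi> \<Delta> J m r \<alpha>"
proof
  assume "is_wall \<alpha> (real r) S \<and> (\<forall>x\<in>S. \<alpha> \<bullet> x < real r)"
  then have wall: "is_wall \<alpha> (real r) S" and below: "\<And>x. x \<in> S \<Longrightarrow> \<alpha> \<bullet> x < real r" by auto
  obtain z where z: "z \<in> alcove rk_ext" using alcove_nonempty[OF shi_rk_ext] by blast
  then have ne: "S \<noteq> {}" using S by blast
  \<comment> \<open>The rank equals \<open>r\<close>: a point of the alcove gives
    \<open>rk \<alpha> \<le> r\<close>, and a point of the facet, where the upper bound of the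
    region persists in the closure, gives the converse.\<close>
  have "real (rk \<alpha>) - 1 < \<alpha> \<bullet> z"
    using alcove_lower[OF shi_rk_ext z pos_root[OF a]] rk_ext_pos[OF a] by simp
  moreover have "\<alpha> \<bullet> z < real r" using below z S by blast
  ultimately have le: "rk \<alpha> \<le> r" by linarith
  obtain F where F: "F facet_of closure S" "F \<subseteq> hyp \<alpha> (real r)" using wall unfolding is_wall_def by blast
  obtain y where "y \<in> F" using F(1) by (auto simp: facet_of_def)
  then have y: "y \<in> closure S" "\<alpha> \<bullet> y = real r" using F facet_of_imp_subset by (auto simp: hyp_def)
  have up: "\<mu> \<bullet> x \<le> real (rk \<mu>)" if "\<mu> \<in> Pos" "rk \<mu> \<le> m" "x \<in> S" for \<mu> x
    using region_upper[of x \<mu>] that S by force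
  have "real r \<le> rk \<alpha>" using closure_inner_le[OF up[OF a]] y le r by force
  then have rk: "rk \<alpha> = r" using le by simp
  have np: False if bg: "\<beta> \<in> \<Phi>" "\<gamma> \<in> \<Phi>" "\<alpha> = \<beta> + \<gamma>" and pq: "rk_ext \<alpha> = p + q"
    and bounds: "\<And>x. x \<in> S \<Longrightarrow> \<beta> \<bullet> x \<le> of_int p" "\<And>x. x \<in> S \<Longrightarrow> \<gamma> \<bullet> x \<le> of_int q" for \<beta> \<gamma> p q
  proof -
    have k: "real r = of_int p + of_int q" using pq rk_ext_pos[OF a] rk by simp
    obtain t where "\<beta> = t *\<^sub>R \<alpha>"
      using is_wall_sum_parallel[OF wall S(1) ne bg(3) k bounds] by blast
    then show False using root_multiple[OF pos_root[OF a] bg(1)] bg by simp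
  qed
  show "indecomposable \<Phi> \<Delta> J m r \<alpha>" unfolding indecomposable_iff[OF r a]
  proof (intro conjI ballI impI notI)
    assume "\<exists>\<beta>\<in>Pos. \<exists>\<gamma>\<in>Pos. \<alpha> = \<beta> + \<gamma> \<and> rk \<alpha> = rk \<beta> + rk \<gamma>"
    then obtain \<beta> \<gamma> where bg: "\<beta> \<in> Pos" "\<gamma> \<in> Pos" "\<alpha> = \<beta> + \<gamma>" "rk \<alpha> = rk \<beta> + rk \<gamma>" by blast
    then have "rk \<beta> \<le> m" "rk \<gamma> \<le> m" using rk r by auto
    then show False
      using np[OF pos_root[OF bg(1)] pos_root[OF bg(2)] bg(3), of "int (rk \<beta>)" "int (rk \<gamma>)"]
        bg up rk_ext_pos[OF a] by simp
  next
    fix \<beta> assume b: "\<beta> \<in> Pos" "\<alpha> + \<beta> \<in> Pos" "rk (\<alpha> + \<beta>) \<le> m"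
    show "rk \<alpha> + rk \<beta> \<le> rk (\<alpha> + \<beta>)"
    proof (rule ccontr)
      assume "\<not> ?thesis"
      \<comment> \<open>By \<open>rk_add_ge\<close> the bound can fail by exactly one, which makes
        \<alpha> the tight sum of \<open>\<alpha> + \<beta>\<close> and
        \<open>- \<beta>\<close>.\<close>
      then have eq: "rk \<alpha> + rk \<beta> = rk (\<alpha> + \<beta>) + 1" using rk_add_ge[OF b(2) a b(1) refl] by simp
      then have "rk \<beta> - 1 \<le> m" using b rk r by simp
      then have "real (rk \<beta>) - 1 < \<beta> \<bullet> x" if "x \<in> S" for x using region_lower b(1) that S by blast
      then have low: "- \<beta> \<bullet> x \<le> of_int (1 - int (rk \<beta>))" if "x \<in> S" for x using that by force
      show False
        using np[OF pos_root[OF b(2)] uminus_root[OF pos_root[OF b(1)]], of "int (rk (\<alpha> + \<beta>))" "1 - int (rk \<beta>)"]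
          eq low up b rk_ext_pos[OF a] by simp
    qed
  qed (rule rk)
next
  assume ind: "indecomposable \<Phi> \<Delta> J m r \<alpha>"
  then have rk: "rk \<alpha> = r" by (simp add: indecomposable_iff[OF r a])
  have below: "\<alpha> \<bullet> x < real r" if "x \<in> S" for x using region_upper[of x \<alpha>] a r rk that S by auto
  obtain x where x: "\<alpha> \<bullet> x = of_int (rk_ext \<alpha>)" "\<forall>b\<in>\<Phi>. b \<noteq> \<alpha> \<longrightarrow> b \<bullet> x < of_int (rk_ext b)"
    using ex_point_on_one_hyperplane[OF shi_rk_ext pos_root[OF a] indecomposable_not_tight[OF r a ind]] by blast
  let ?U = "\<Inter>b\<in>\<Phi> - {\<alpha>}. {y. b \<bullet> y < of_int (rk_ext b)}"
  have "open ?U" using fin by (intro open_INT ballI open_halfspace_lt) auto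
  moreover have "x \<in> ?U" using x by auto
  ultimately obtain e where e: "0 < e" "ball x e \<subseteq> ?U" by (meson open_contains_ball)
  have "is_wall \<alpha> (real r) S"
  proof (rule is_wall_if_point[OF _ S(2) below _ e(1)])
    show "\<alpha> \<noteq> 0" using pos_root[OF a] zero_notin by blast
    show "\<alpha> \<bullet> x = real r" using x rk rk_ext_pos[OF a] by simp
    fix y assume y: "y \<in> ball x e" "\<alpha> \<bullet> y < real r"
    have "b \<bullet> y < of_int (rk_ext b)" if "b \<in> \<Phi>" for b
      using e(2) y that rk rk_ext_pos[OF a] by (cases "b = \<alpha>") auto
    then have "y \<in> alcove rk_ext" by (simp add: alcove_def)
    then show "y \<in> S" using S by blast
  qed
  then show "is_wall \<alpha> (real r) S \<and> (\<forall>x\<in>S. \<alpha> \<bullet> x < real r)" using below by blast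
qed

text \<open>The values of \<open>r_w\<close> at positive roots give the upper bounds there and,
  through the lower ends of the strips, those at negative roots; \<open>affine_weyl_alcove\<close>
  turns the inclusion into equality.\<close>

lemma affine_weyl_image_eq_alcove:
  assumes th: "highest_root \<Phi> \<Delta> \<theta>" and w: "w \<in> affine_weyl \<Phi>"
    and rw: "\<forall>\<alpha>\<in>Pos. r_w \<Delta> \<theta> w \<alpha> = int (rk \<alpha>)"
  shows "w ` fund_alcove \<Delta> \<theta> = alcove rk_ext"
proof -
  have "y \<in> alcove rk_ext" if y: "y \<in> w ` fund_alcove \<Delta> \<theta>" for y
    unfolding alcove_def
  proof (intro CollectI ballI)
    fix a assume "a \<in> \<Phi>"
    then show "a \<bullet> y < of_int (rk_ext a)"
    proof (cases rule: pos_or_neg_cases)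
      case 1
      then show ?thesis using r_w_bounds[OF th w pos_root[OF 1] y] rw by (simp add: rk_ext_pos)
    next
      case (2 \<eta>)
      then show ?thesis using r_w_bounds[OF th w pos_root[OF 2(1)] y] rw by (simp add: rk_ext_neg)
    qed
  qed
  then have "w ` alcove fund_shi \<subseteq> alcove rk_ext" by (auto simp: fund_alcove_eq[OF th])
  then show ?thesis using affine_weyl_alcove[OF w shi_fund shi_rk_ext] fund_alcove_eq[OF th] by simp
qed

end

theorem theorem3p11:
  fixes \<Phi> \<Delta> :: "'a::euclidean_space set" and \<theta> :: 'a
    and J :: "nat \<Rightarrow> 'a set" and m r :: nat
  assumes "root_system \<Phi>" and "irreducible_rs \<Phi>"
    and "simple_system \<Phi> \<Delta>" and "highest_root \<Phi> \<Delta> \<theta>"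
    and "pos_geom_chain \<Phi> \<Delta> J m"
    and "1 \<le> r" and "r \<le> m"
  shows "{\<alpha> \<in> pos_roots \<Phi> \<Delta>. indecomposable \<Phi> \<Delta> J m r \<alpha>}
           = {\<alpha> \<in> pos_roots \<Phi> \<Delta>. is_wall \<alpha> (real r) (region_of \<Phi> \<Delta> J m)
                 \<and> not_separates \<alpha> (real r) (region_of \<Phi> \<Delta> J m) (fund_alcove \<Delta> \<theta>)}
      \<and> (\<forall>w\<in>affine_weyl \<Phi>.
           (\<forall>\<alpha>\<in>pos_roots \<Phi> \<Delta>. r_w \<Delta> \<theta> w \<alpha> = int (rank_J J m \<alpha>)) \<longrightarrow>
           {\<alpha> \<in> pos_roots \<Phi> \<Delta>. indecomposable \<Phi> \<Delta> J m r \<alpha>}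
           = {\<alpha> \<in> pos_roots \<Phi> \<Delta>. is_wall \<alpha> (real r) (w ` fund_alcove \<Delta> \<theta>)
                 \<and> not_separates \<alpha> (real r) (w ` fund_alcove \<Delta> \<theta>) (fund_alcove \<Delta> \<theta>)})"
proof -
  interpret ideal_chain \<Phi> \<Delta> J m by unfold_locales (fact assms)+
  \<comment> \<open>Used with \<open>S = R\<close> for the second set and with
    \<open>S = alcove rk_ext\<close> for the third.\<close>
  have *: "{\<alpha> \<in> Pos. indecomposable \<Phi> \<Delta> J m r \<alpha>}
      = {\<alpha> \<in> Pos. is_wall \<alpha> (real r) S \<and> not_separates \<alpha> (real r) S (fund_alcove \<Delta> \<theta>)}"
    if "open S" "convex S" "alcove rk_ext \<subseteq> S" "S \<subseteq> R" for S
  proof (rule Collect_cong, rule conj_cong[OF refl])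
    fix \<alpha> assume a: "\<alpha> \<in> Pos"
    show "indecomposable \<Phi> \<Delta> J m r \<alpha> \<longleftrightarrow>
        is_wall \<alpha> (real r) S \<and> not_separates \<alpha> (real r) S (fund_alcove \<Delta> \<theta>)"
      using wall_iff_indecomposable[OF that assms(6,7) a]
        not_separates_fund_alcove_iff[OF assms(4) a assms(6), of S] by blast
  qed
  show ?thesis
  proof (intro conjI ballI impI)
    fix w assume "w \<in> affine_weyl \<Phi>" "\<forall>\<alpha>\<in>Pos. r_w \<Delta> \<theta> w \<alpha> = int (rk \<alpha>)"
    then have "w ` fund_alcove \<Delta> \<theta> = alcove rk_ext"
      using affine_weyl_image_eq_alcove[OF assms(4)] by blast
    then show "{\<alpha> \<in> Pos. indecomposable \<Phi> \<Delta> J m r \<alpha>}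
        = {\<alpha> \<in> Pos. is_wall \<alpha> (real r) (w ` fund_alcove \<Delta> \<theta>)
            \<and> not_separates \<alpha> (real r) (w ` fund_alcove \<Delta> \<theta>) (fund_alcove \<Delta> \<theta>)}"
      using *[of "alcove rk_ext"] open_alcove convex_alcove alcove_subset_region by simp
  qed (use *[of R] open_region convex_region alcove_subset_region in simp)
qed

end
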